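(* Let $\alpha\in(0,1)$. Suppose that the informative set constructor $\mathcal C^{\mathcal I}$ is permutation-invariant with respect to $\{Z_i\}_{i=1}^{n+m}$, that the data points $(X_i,Y_i)$, $i\in[n+m]$, are exchangeable conditional on the training data $\mathcal D^{\mathrm{tr}}$, and that the matrix $\mathbb A_\Psi$ is positive definite. Then the SCIP procedure run at level $\alpha$ with the diversity-aware scores $$(T_1,\dots,T_{n+m})^\top=\mathbb A_\Psi^{-1}\{(\alpha u_2-u_1)\Psi+(u_2-\alpha u_3)\mathbf 1\}$$ satisfies $\mathrm{FCR}\le\alpha$.
   Context: Write $[k]=\{1,\dots,k\}$. Let $n,m\ge1$. Let $Z_i=(X_i,Y_i)\in\mathcal X\times\mathcal Y$, $i\in[n+m]$, be random pairs; the first $n$ are calibration data, the last $m$ are test data (responses unobserved). $\mathcal I$ is a given collection of subsets of $\mathcal Y$. $\mathbb D$ denotes auxiliary data (e.g. training data $\mathcal D^{\mathrm{tr}}$). Permutation invariance. A mapping $G(\cdot)=G(\cdot\,;Z_1,\dots,Z_{n+m},\mathbb D)$ is permutation-invariant with respect to $\{Z_i\}_{i=1}^{n+m}$ if (a) for any fixed $\mathbb D$ and any permutation $\varsigma$ of $[n+m]$, $G(\cdot\,;Z_1,\dots,Z_{n+m},\mathbb D)=G(\cdot\,;Z_{\varsigma(1)},\dots,Z_{\varsigma(n+m)},\mathbb D)$; and (b) if $Z_1,\dots,Z_{n+m}$ are exchangeable, they remain exchangeable conditional on $\mathbb D$. An informative set constructor is a mapping $\mathcal C^{\mathcal I}:\mathcal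 X\to\mathcal I$, possibly indexed by $(Z_1,\dots,Z_{n+m},\mathbb D)$; $\mathcal C_i^{\mathcal I}=\mathcal C^{\mathcal I}(X_i)$. Diversity-aware scores. $\psi:\mathcal X\to[0,1]$ is an estimate of $x\mapsto\Pr\{Y\notin\mathcal C^{\mathcal I}(X)\mid X=x\}$, permutation-invariant with respect to $\{Z_i\}_{i=1}^{n+m}$ (for instance, learned from the training data). $s:\mathcal X\times\mathcal X\to\mathbb R^+$ is a fixed similarity function. $\psi_i=\psi(X_i)$, $\Psi=(\psi_1,\dots,\psi_{n+m})^\top$, and $\mathbb A_\Psi$ is the $(n+m)\times(n+m)$ matrix with $(i,j)$ entry $(1-\psi_i)(1-\psi_j)s(X_i,X_j)$. $\mathbf 1$ is the all-ones vector in $\mathbb R^{n+m}$, $u_1=\Psi^\top\mathbb A_\Psi^{-1}\Psi$, $u_2=\Psi^\top\mathbb A_\Psi^{-1}\mathbf 1$, $u_3=\mathbf 1^\top\mathbb A_\Psi^{-1}\mathbf 1$. SCIP with scores $T_1,\dots,T_{n+m}$ at level $\alpha$: for $j\in[m]$, $$p_j^{\mathrm{GC}}=\frac{\sum_{i=1}^n\mathbb I(Y_i\notin\mathcal C_i^{\mathcal I},\,T_i>T_{n+j})+\{1+\sum_{i=1}^n\mathbb I(Y_i\notin\mathcal C_i^{\mathcal I},\,T_i=T_{n+j})\}\,U_j}{n+1},$$ where $U_1,\dots,U_m$ are i.i.d. $\mathrm{Unif}(0,1)$, independent of everything else; $\widehat\alpha=\max\{a\in[0,1]:\frac{\alpha}{m}\sum_{j=1}^m\mathbb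 I(p_j^{\mathrm{GC}}\le a)\ge a\}$, $\mathcal S=\{j\in[m]:p_j^{\mathrm{GC}}\le\widehat\alpha\}$; report $\{\mathcal C_{n+j}^{\mathcal I}:j\in\mathcal S\}$. $\mathrm{FCR}=\mathbb E\Big[\frac{\sum_{j\in\mathcal S}\mathbb I(Y_{n+j}\notin\mathcal C_{n+j}^{\mathcal I})}{\max(1,|\mathcal S|)}\Big]$. *)

theory Defs
  imports "HOL-Probability.Probability"
begin

text \<open>
  The index set of the \<open>n + m\<close> data points is a sum \<open>'n + 'm\<close> of two finite (hence nonempty) types:
  \<open>Inl i\<close> is a calibration index, \<open>Inr j\<close> a test index, \<open>n = CARD('n)\<close> and \<open>m = CARD('m)\<close>.
  A full data set is a function \<open>z\<close> from indices to pairs (feature, response).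
  An object \<open>G(x; z, d)\<close> indexed by a data set and by auxiliary data is written \<open>G z d x\<close>.
\<close>

definition exchangeable :: "'a measure \<Rightarrow> 'z measure \<Rightarrow> ('k \<Rightarrow> 'a \<Rightarrow> 'z) \<Rightarrow> bool" where
  "exchangeable M N Z \<longleftrightarrow>
    (\<forall>\<sigma>. \<sigma> permutes UNIV \<longrightarrow>
      distr M (Pi\<^sub>M UNIV (\<lambda>_. N)) (\<lambda>\<omega> i. Z (\<sigma> i) \<omega>) =
      distr M (Pi\<^sub>M UNIV (\<lambda>_. N)) (\<lambda>\<omega> i. Z i \<omega>))"

definition cond_prob_given ::
    "'a measure \<Rightarrow> 'd measure \<Rightarrow> ('a \<Rightarrow> 'd) \<Rightarrow> 'a set \<Rightarrow> 'a \<Rightarrow> real" where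
  "cond_prob_given M MD D E = real_cond_exp M (vimage_algebra (space M) D MD) (indicator E)"

definition cond_exchangeable ::
    "'a measure \<Rightarrow> 'z measure \<Rightarrow> ('k \<Rightarrow> 'a \<Rightarrow> 'z) \<Rightarrow> 'd measure \<Rightarrow> ('a \<Rightarrow> 'd) \<Rightarrow> bool" where
  "cond_exchangeable M N Z MD D \<longleftrightarrow>
    (\<forall>\<sigma>. \<sigma> permutes UNIV \<longrightarrow>
      (\<forall>A \<in> sets (Pi\<^sub>M UNIV (\<lambda>_. N)). AE \<omega> in M.
        cond_prob_given M MD D {\<omega>' \<in> space M. (\<lambda>i. Z (\<sigma> i) \<omega>') \<in> A} \<omega> =
        cond_prob_given M MD D {\<omega>' \<in> space M. (\<lambda>i. Z i \<omega>') \<in> A} \<omega>))"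

definition permutation_invariant ::
    "'a measure \<Rightarrow> 'x measure \<Rightarrow> 'y measure \<Rightarrow> 'd measure \<Rightarrow> ('k \<Rightarrow> 'a \<Rightarrow> 'x \<times> 'y) \<Rightarrow> ('a \<Rightarrow> 'd) \<Rightarrow>
     (('k \<Rightarrow> 'x \<times> 'y) \<Rightarrow> 'd \<Rightarrow> 'x \<Rightarrow> 'r) \<Rightarrow> bool" where
  "permutation_invariant M MX MY MD Z D G \<longleftrightarrow>
    (\<forall>d \<in> space MD. \<forall>\<sigma>. \<sigma> permutes UNIV \<longrightarrow>
      (\<forall>z \<in> space (Pi\<^sub>M UNIV (\<lambda>_. MX \<Otimes>\<^sub>M MY)). \<forall>x \<in> space MX.
        G z d x = G (\<lambda>i. z (\<sigma> i)) d x)) \<and>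
    (exchangeable M (MX \<Otimes>\<^sub>M MY) Z \<longrightarrow> cond_exchangeable M (MX \<Otimes>\<^sub>M MY) Z MD D)"

text \<open>Symmetry is not part of this definition; a symmetric positive definite matrix is a special case.\<close>

definition positive_definite :: "real^'k^'k \<Rightarrow> bool" where
  "positive_definite A \<longleftrightarrow> (\<forall>v. v \<noteq> 0 \<longrightarrow> v \<bullet> (A *v v) > 0)"

definition psi_vec ::
    "(('k \<Rightarrow> 'x \<times> 'y) \<Rightarrow> 'd \<Rightarrow> 'x \<Rightarrow> real) \<Rightarrow> ('k \<Rightarrow> 'x \<times> 'y) \<Rightarrow> 'd \<Rightarrow> real^'k" where
  "psi_vec \<psi> z d = (\<chi> i. \<psi> z d (fst (z i)))"

definition diversity_matrix ::
    "('x \<Rightarrow> 'x \<Rightarrow> real) \<Rightarrow> (('k \<Rightarrow> 'x \<times> 'y) \<Rightarrow> 'd \<Rightarrow> 'x \<Rightarrow> real) \<Rightarrow>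
     ('k \<Rightarrow> 'x \<times> 'y) \<Rightarrow> 'd \<Rightarrow> real^'k^'k" where
  "diversity_matrix s \<psi> z d =
    (\<chi> i j. (1 - psi_vec \<psi> z d $ i) * (1 - psi_vec \<psi> z d $ j) * s (fst (z i)) (fst (z j)))"

text \<open>
  For a singular matrix, \<open>matrix_inv\<close> is one fixed unspecified matrix; the theorem excludes
  this case almost surely.
\<close>

definition diversity_scores ::
    "real \<Rightarrow> ('x \<Rightarrow> 'x \<Rightarrow> real) \<Rightarrow> (('k \<Rightarrow> 'x \<times> 'y) \<Rightarrow> 'd \<Rightarrow> 'x \<Rightarrow> real) \<Rightarrow>
     ('k \<Rightarrow> 'x \<times> 'y) \<Rightarrow> 'd \<Rightarrow> real^'k" where
  "diversity_scores \<alpha> s \<psi> z d =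
    (let \<Psi> = psi_vec \<psi> z d;
         one = (\<chi> i. 1);
         B = matrix_inv (diversity_matrix s \<psi> z d);
         u1 = \<Psi> \<bullet> (B *v \<Psi>);
         u2 = \<Psi> \<bullet> (B *v one);
         u3 = one \<bullet> (B *v one)
     in B *v ((\<alpha> * u2 - u1) *\<^sub>R \<Psi> + (u2 - \<alpha> * u3) *\<^sub>R one))"

definition miscovered ::
    "(('k \<Rightarrow> 'x \<times> 'y) \<Rightarrow> 'd \<Rightarrow> 'x \<Rightarrow> 'y set) \<Rightarrow> ('k \<Rightarrow> 'x \<times> 'y) \<Rightarrow> 'd \<Rightarrow> 'k \<Rightarrow> bool" where
  "miscovered C z d i \<longleftrightarrow> snd (z i) \<notin> C z d (fst (z i))"

text \<open>The argument \<open>b\<close> holds the miscoverage indicators of the calibration points only.\<close>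

definition gc_pvalue ::
    "('n::finite \<Rightarrow> bool) \<Rightarrow> real^('n + 'm::finite) \<Rightarrow> ('m \<Rightarrow> real) \<Rightarrow> 'm \<Rightarrow> real" where
  "gc_pvalue b T u j =
    ((\<Sum>i\<in>UNIV. of_bool (b i \<and> T $ Inl i > T $ Inr j)) +
     (1 + (\<Sum>i\<in>UNIV. of_bool (b i \<and> T $ Inl i = T $ Inr j))) * u j) / (real CARD('n) + 1)"

text \<open>The maximum exists for \<open>\<alpha> \<ge> 0\<close>, since the step function of \<open>a\<close> is monotone and \<open>a = 0\<close> qualifies.\<close>

definition scip_threshold :: "real \<Rightarrow> ('m::finite \<Rightarrow> real) \<Rightarrow> real" where
  "scip_threshold \<alpha> p =
    (GREATEST a. a \<in> {0..1} \<and> \<alpha> / real CARD('m) * (\<Sum>j\<in>UNIV. of_bool (p j \<le> a)) \<ge> a)"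

definition scip_selection ::
    "real \<Rightarrow> ('n::finite \<Rightarrow> bool) \<Rightarrow> real^('n + 'm::finite) \<Rightarrow> ('m \<Rightarrow> real) \<Rightarrow> 'm set" where
  "scip_selection \<alpha> b T u = {j. gc_pvalue b T u j \<le> scip_threshold \<alpha> (gc_pvalue b T u)}"

definition FCR :: "'a measure \<Rightarrow> ('a \<Rightarrow> 'm::finite set) \<Rightarrow> ('a \<Rightarrow> 'm \<Rightarrow> bool) \<Rightarrow> real" where
  "FCR M S b = (\<integral>\<omega>. (\<Sum>j\<in>S \<omega>. of_bool (b \<omega> j)) / real (max 1 (card (S \<omega>))) \<partial>M)"

end

theory Submission
  imports Defs
begin

text \<open>
  Fix a test point \<open>j\<close>. Conditional exchangeability, together with the independence of \<open>U\<close>, shows that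
  the law of the data is unchanged when \<open>j\<close> trades places with a calibration point. So the
  expected share of \<open>j\<close> in the false coverage proportion may be averaged over the \<open>n + 1\<close>
  transpositions of \<open>j\<close> with a slot in (calibration points and \<open>j\<close>), and over \<open>U\<^sub>j\<close> alone.
  Since \<open>C\<close> and the scores are permutation equivariant, only deterministic quantities
  remain. As the point moved to position \<open>j\<close> and the value of \<open>U\<^sub>j\<close> vary, all other p-values are
  nondecreasing functions of the p-value of \<open>j\<close>, also in the presence of ties. Hence the number
  of selections is antitone in that p-value; if \<open>r\<close> is the least number of selections among the
  configurations in which \<open>j\<close> is wrongly selected, then in all of them the p-value is at most \<open>\<alpha>r/m\<close>
  and the share is at most \<open>1/r\<close>. The smoothed ranks of the miscovered points put mass at most
  \<open>\<alpha>r/m\<close> on this event, so \<open>j\<close> contributes at most \<open>\<alpha>/m\<close>, and summing over \<open>j\<close> gives \<open>\<alpha>\<close>.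
\<close>

subsection \<open>Step-up selection and smoothed ranks\<close>

text \<open>The rejection count of the Benjamini-Hochberg step-up procedure. An integer takes the
  place of the real maximiser in \<open>scip_threshold\<close>; \<open>r = 0\<close> always
  qualifies, so the maximum is over a nonempty finite set.\<close>

definition bh_count :: "real \<Rightarrow> ('m::finite \<Rightarrow> real) \<Rightarrow> nat" where
  "bh_count \<alpha> p = Max {r. r \<le> CARD('m) \<and> r \<le> card {l. p l \<le> \<alpha> * real r / real CARD('m)}}"

lemma card_Collect_mono_finite:
  fixes P Q :: "'m::finite \<Rightarrow> bool"
  assumes "\<And>l. P l \<Longrightarrow> Q l"
  shows "card {l. P l} \<le> card {l. Q l}"
  using assms by (intro card_mono) auto

lemma bh_count_in:
  fixes p :: "'m::finite \<Rightarrow> real"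
  shows "bh_count \<alpha> p \<le> CARD('m)"
    and "bh_count \<alpha> p \<le> card {l. p l \<le> \<alpha> * real (bh_count \<alpha> p) / real CARD('m)}"
proof -
  let ?R = "{r. r \<le> CARD('m) \<and> r \<le> card {l. p l \<le> \<alpha> * real r / real CARD('m)}}"
  have "Max ?R \<in> ?R"
    by (rule Max_in) (auto intro: exI[of _ 0])
  then show "bh_count \<alpha> p \<le> CARD('m)"
    and "bh_count \<alpha> p \<le> card {l. p l \<le> \<alpha> * real (bh_count \<alpha> p) / real CARD('m)}"
    by (simp_all add: bh_count_def)
qed

lemma le_bh_count:
  fixes p :: "'m::finite \<Rightarrow> real"
  assumes "r \<le> card {l. p l \<le> \<alpha> * real r / real CARD('m)}"
  shows "r \<le> bh_count \<alpha> p"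
proof -
  have "card {l. p l \<le> \<alpha> * real r / real CARD('m)} \<le> CARD('m)"
    by (simp add: card_mono)
  with assms show ?thesis
    unfolding bh_count_def by (intro Max_ge) auto
qed

lemma bh_count_antimono:
  fixes p q :: "'m::finite \<Rightarrow> real"
  assumes "\<And>l. p l \<le> q l"
  shows "bh_count \<alpha> q \<le> bh_count \<alpha> p"
proof (rule le_bh_count)
  have "bh_count \<alpha> q \<le> card {l. q l \<le> \<alpha> * real (bh_count \<alpha> q) / real CARD('m)}"
    by (rule bh_count_in)
  also have "\<dots> \<le> card {l. p l \<le> \<alpha> * real (bh_count \<alpha> q) / real CARD('m)}"
    using assms by (intro card_Collect_mono_finite) (rule order_trans)
  finally show "bh_count \<alpha> q \<le> card {l. p l \<le> \<alpha> * real (bh_count \<alpha> q) / real CARD('m)}" .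
qed

text \<open>If exactly r p-values are at most a qualifying \<open>a\<close>, then a \<le> \<alpha> r
  / m. Raising the level from \<open>a\<close> to \<alpha> r / m loses none of them, so r is at most
  \<open>bh_count\<close>. The bound \<alpha> \<le> 1 keeps the maximiser inside the unit
  interval.\<close>

lemma scip_threshold_eq:
  fixes p :: "'m::finite \<Rightarrow> real"
  assumes "0 \<le> \<alpha>" "\<alpha> \<le> 1"
  shows "scip_threshold \<alpha> p = \<alpha> * real (bh_count \<alpha> p) / real CARD('m)"
  unfolding scip_threshold_def
proof (rule Greatest_equality)
  let ?m = "real CARD('m)" and ?r = "bh_count \<alpha> p"
  have sum_card: "(\<Sum>j\<in>UNIV. of_bool (p j \<le> a)) = real (card {j. p j \<le> a})" for a
    by (simp add: of_bool_def sum.If_cases)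
  have "\<alpha> * real ?r \<le> 1 * ?m"
    using assms bh_count_in(1)[of \<alpha> p] by (intro mult_mono) auto
  moreover have "\<alpha> * real ?r \<le> \<alpha> * real (card {j. p j \<le> \<alpha> * real ?r / ?m})"
    using bh_count_in(2)[of \<alpha> p] assms by (intro mult_left_mono) auto
  ultimately show "\<alpha> * real ?r / ?m \<in> {0..1} \<and>
      \<alpha> / ?m * (\<Sum>j\<in>UNIV. of_bool (p j \<le> \<alpha> * real ?r / ?m)) \<ge> \<alpha> * real ?r / ?m"
    using assms by (simp add: sum_card field_simps)
next
  let ?m = "real CARD('m)" and ?r = "bh_count \<alpha> p"
  fix a assume a: "a \<in> {0..1} \<and> \<alpha> / ?m * (\<Sum>j\<in>UNIV. of_bool (p j \<le> a)) \<ge> a"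
  define r where "r = card {j. p j \<le> a}"
  have ar: "a \<le> \<alpha> * real r / ?m"
    using a by (simp add: r_def of_bool_def sum.If_cases)
  have "r \<le> bh_count \<alpha> p"
    using ar unfolding r_def by (intro le_bh_count card_Collect_mono_finite) (rule order_trans)
  then have "\<alpha> * real r / ?m \<le> \<alpha> * real ?r / ?m"
    using assms by (intro divide_right_mono mult_left_mono) auto
  with ar show "a \<le> \<alpha> * real ?r / ?m" by simp
qed

text \<open>The definition of \<open>bh_count\<close> only gives at least r p-values below \<alpha>
  r / m. If c of them lie there, they also lie below the larger level \<alpha> c / m, so c qualifies
  too and maximality gives c \<le> r.\<close>

lemma card_le_scip_threshold:
  fixes p :: "'m::finite \<Rightarrow> real"
  assumes "0 \<le> \<alpha>" "\<alpha> \<le> 1"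
  shows "card {j. p j \<le> scip_threshold \<alpha> p} = bh_count \<alpha> p"
proof (rule antisym)
  let ?m = "real CARD('m)" and ?r = "bh_count \<alpha> p"
  let ?c = "card {j. p j \<le> scip_threshold \<alpha> p}"
  show le: "?r \<le> ?c"
    unfolding scip_threshold_eq[OF assms] by (rule bh_count_in)
  have "scip_threshold \<alpha> p \<le> \<alpha> * real ?c / ?m"
    unfolding scip_threshold_eq[OF assms]
    using le assms by (intro divide_right_mono mult_left_mono) (auto simp: scip_threshold_eq[OF assms])
  then show "?c \<le> ?r"
    by (intro le_bh_count card_Collect_mono_finite) (rule order_trans)
qed

text \<open>Selection becomes a finite disjunction of comparisons between sums, free of
  \<open>GREATEST\<close> and \<open>Max\<close>, from which measurability can be read off.\<close>

lemma le_scip_threshold_iff: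
  fixes p :: "'m::finite \<Rightarrow> real"
  assumes "0 \<le> \<alpha>" "\<alpha> \<le> 1"
  shows "p j \<le> scip_threshold \<alpha> p \<longleftrightarrow>
    (\<exists>r\<in>{..CARD('m)}. real r \<le> (\<Sum>l\<in>UNIV. of_bool (p l \<le> \<alpha> * real r / real CARD('m))) \<and>
      p j \<le> \<alpha> * real r / real CARD('m))"
proof -
  let ?m = "real CARD('m)"
  have sum_card: "(\<Sum>j\<in>UNIV. of_bool (p j \<le> a)) = real (card {j. p j \<le> a})" for a
    by (simp add: of_bool_def sum.If_cases)
  have "p j \<le> \<alpha> * real (bh_count \<alpha> p) / ?m"
    if "r \<le> card {l. p l \<le> \<alpha> * real r / ?m}" "p j \<le> \<alpha> * real r / ?m" for r
  proof -
    have "\<alpha> * real r / ?m \<le> \<alpha> * real (bh_count \<alpha> p) / ?m"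
      using assms le_bh_count[OF that(1)] by (intro divide_right_mono mult_left_mono) auto
    with that(2) show ?thesis by simp
  qed
  then show ?thesis
    unfolding scip_threshold_eq[OF assms] sum_card of_nat_le_iff using bh_count_in[of \<alpha> p] by auto
qed

lemma scip_selection_measurable:
  fixes b :: "'a \<Rightarrow> 'n::finite \<Rightarrow> bool" and T :: "'a \<Rightarrow> real^('n + 'm::finite)" and u :: "'a \<Rightarrow> 'm \<Rightarrow> real"
  assumes "0 \<le> \<alpha>" "\<alpha> \<le> 1"
    and b[measurable]: "\<And>i. Measurable.pred N (\<lambda>x. b x i)"
    and T[measurable]: "\<And>k. (\<lambda>x. T x $ k) \<in> borel_measurable N"
    and u[measurable]: "\<And>j. (\<lambda>x. u x j) \<in> borel_measurable N"
  shows "Measurable.pred N (\<lambda>x. j \<in> scip_selection \<alpha> (b x) (T x) (u x))"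
proof -
  have [measurable]: "(\<lambda>x. gc_pvalue (b x) (T x) (u x) l) \<in> borel_measurable N" for l
    unfolding gc_pvalue_def of_bool_def by measurable
  show ?thesis
    unfolding scip_selection_def mem_Collect_eq le_scip_threshold_iff[OF assms(1,2)] of_bool_def
    by measurable
qed

lemma card_scip_selection_measurable:
  fixes b :: "'a \<Rightarrow> 'n::finite \<Rightarrow> bool" and T :: "'a \<Rightarrow> real^('n + 'm::finite)" and u :: "'a \<Rightarrow> 'm \<Rightarrow> real"
  assumes "0 \<le> \<alpha>" "\<alpha> \<le> 1"
    and b: "\<And>i. Measurable.pred N (\<lambda>x. b x i)"
    and T: "\<And>k. (\<lambda>x. T x $ k) \<in> borel_measurable N"
    and u: "\<And>j. (\<lambda>x. u x j) \<in> borel_measurable N"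
  shows "(\<lambda>x. real (card (scip_selection \<alpha> (b x) (T x) (u x)))) \<in> borel_measurable N"
proof -
  note [measurable] = scip_selection_measurable[OF assms]
  have "real (card (scip_selection \<alpha> (b x) (T x) (u x))) =
      (\<Sum>j\<in>UNIV. if j \<in> scip_selection \<alpha> (b x) (T x) (u x) then 1 else 0)" for x
    by (simp add: sum.If_cases)
  then show ?thesis by simp
qed

text \<open>As v runs through the unit interval, the smoothed rank of \<open>k\<close> sweeps an
  interval of length \<open>E K k\<close>, the number of points tied with \<open>k\<close>. Together
  these tied points contribute the length of the part of that interval below \<open>x\<close>.
  Different score levels give disjoint intervals that start at 0 and follow each other, so the total
  is at most \<open>x\<close>.\<close>

lemma sum_smoothed_rank_le:
  fixes t :: "'k \<Rightarrow> real" and x :: real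
  defines "G \<equiv> \<lambda>K k. \<Sum>i\<in>K. of_bool (t i > t k)"
    and "E \<equiv> \<lambda>K k. \<Sum>i\<in>K. of_bool (t i = t k)"
  assumes K: "finite K" and x: "0 \<le> x"
  shows "(\<Sum>k\<in>K. measure lborel {v\<in>{0<..<1}. G K k + E K k * v \<le> x}) \<le> x"
proof -
  have E_pos: "E K k > 0" if k: "k \<in> K" for k
  proof -
    have "(1::real) = (\<Sum>i\<in>{k}. of_bool (t i = t k))" by simp
    also have "\<dots> \<le> E K k" unfolding E_def using K k by (intro sum_mono2) auto
    finally show ?thesis by simp
  qed
  show ?thesis
  proof (cases "\<exists>k\<in>K. G K k < x")
    case False
    have "measure lborel {v\<in>{0<..<1}. G K k + E K k * v \<le> x} = 0" if k: "k \<in> K" for k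
    proof -
      have "E K k * v > 0" if "v > 0" for v
        using that E_pos[OF k] by simp
      moreover have "G K k \<ge> x" using False k by auto
      ultimately have "{v\<in>{0<..<1}. G K k + E K k * v \<le> x} = {}"
        by (smt (verit) Collect_empty_eq greaterThanLessThan_iff)
      then show ?thesis by (simp only: measure_empty)
    qed
    with x show ?thesis by (simp add: sum.neutral)
  next
    case True
    \<comment> \<open>Points scoring above \<open>k0\<close>, the lowest of those with \<open>G < x\<close>, contribute at most
      \<open>G K k0\<close> in total, ties with \<open>k0\<close> contribute \<open>x - G K k0\<close>, and all others nothing.\<close>
    define L where "L = {k\<in>K. G K k < x}"
    have L: "finite L" "L \<noteq> {}" using True K by (auto simp: L_def)
    obtain k0 where k0: "k0 \<in> L" and min: "\<And>k. k \<in> L \<Longrightarrow> t k0 \<le> t k"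
      using L by (metis arg_min_if_finite(1) arg_min_least)
    define e where "e = E K k0"
    define g where "g = G K k0"
    have e_pos: "e > 0" using k0 E_pos by (simp add: e_def L_def)
    let ?\<mu> = "\<lambda>k. measure lborel {v\<in>{0<..<1}. G K k + E K k * v \<le> x}"
    have bound: "?\<mu> k \<le> of_bool (t k > t k0) + of_bool (t k = t k0) * ((x - g) / e)" if k: "k \<in> K" for k
    proof -
      consider "t k > t k0" | "t k = t k0" | "t k < t k0" by linarith
      then show ?thesis
      proof cases
        case 1
        have "?\<mu> k \<le> measure lborel {0<..<1::real}"
          by (rule measure_mono_fmeasurable) (auto simp: fmeasurable_def)
        then show ?thesis using 1 by simp
      next
        case 2
        then have "G K k = g" "E K k = e" by (simp_all add: g_def e_def G_def E_def)
        then have "?\<mu> k \<le> measure lborel {0..(x - g) / e}"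
          using e_pos
          by (intro measure_mono_fmeasurable) (auto simp: fmeasurable_def emeasure_lborel_Icc_eq field_simps)
        also have "\<dots> = (x - g) / e"
          using e_pos k0 by (subst measure_lborel_Icc) (auto simp: L_def g_def)
        finally show ?thesis using 2 by simp
      next
        case 3
        then have "k \<notin> L" using min by force
        then have "G K k \<ge> x" using k by (auto simp: L_def)
        moreover have "E K k > 0" using k by (rule E_pos)
        ultimately have "{v\<in>{0<..<1}. G K k + E K k * v \<le> x} = {}"
          by (auto simp: not_le) (smt (verit) mult_pos_pos)
        then have "?\<mu> k = 0" by (simp only: measure_empty)
        then show ?thesis using 3 by simp
      qed
    qed
    have "(\<Sum>k\<in>K. ?\<mu> k) \<le> (\<Sum>k\<in>K. of_bool (t k > t k0) + of_bool (t k = t k0) * ((x - g) / e))"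
      by (intro sum_mono bound)
    also have "\<dots> = g + e * ((x - g) / e)"
      by (simp only: sum.distrib sum_distrib_right[symmetric] g_def e_def G_def E_def)
    also have "\<dots> = x" using e_pos by simp
    finally show ?thesis .
  qed
qed

section \<open>Exchanging a test point with a calibration point\<close>

definition slots :: "'m \<Rightarrow> ('n + 'm) set" where
  "slots j = insert (Inr j) (range Inl)"

lemma finite_slots [simp]: "finite (slots j :: ('n::finite + 'm) set)"
  by (simp add: slots_def)

lemma card_slots: "card (slots j :: ('n::finite + 'm) set) = CARD('n) + 1"
  by (simp add: slots_def card_insert_if image_iff card_image inj_on_def)

text \<open>The transposition permutes the slots and puts \<open>k\<close> in the test position, so
  the calibration positions hold all slots except \<open>k\<close>.\<close>

lemma sum_swapped_calibration:
  fixes f :: "'n::finite + 'm \<Rightarrow> real"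
  assumes k: "k \<in> slots j"
  shows "(\<Sum>i\<in>UNIV. f (Transposition.transpose (Inr j) k (Inl i))) = (\<Sum>i\<in>slots j. f i) - f k"
proof -
  let ?\<tau> = "Transposition.transpose (Inr j) k"
  have "(\<Sum>i\<in>slots j. f i) = (\<Sum>i\<in>slots j. f (?\<tau> i))"
    using k by (intro sum.permute[unfolded comp_def] permutes_swap_id) (auto simp: slots_def)
  also have "\<dots> = f k + (\<Sum>i\<in>range Inl. f (?\<tau> i))"
    unfolding slots_def by (subst sum.insert) auto
  also have "(\<Sum>i\<in>range Inl. f (?\<tau> i)) = (\<Sum>i\<in>UNIV. f (?\<tau> (Inl i)))"
    by (subst sum.reindex) auto
  finally show ?thesis by simp
qed

text \<open>The averaging runs over the pairs of \<open>k\<close>, the point standing in position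
  \<open>j\<close>, and \<open>v\<close>, the randomiser of \<open>j\<close>. The data and the other
  randomisers stay fixed; \<open>k = Inr j\<close> is the original arrangement.\<close>

definition swapped_pvalue ::
    "('n::finite + 'm::finite \<Rightarrow> bool) \<Rightarrow> real^('n + 'm) \<Rightarrow> ('m \<Rightarrow> real) \<Rightarrow> 'm \<Rightarrow> 'n + 'm \<Rightarrow> real \<Rightarrow>
      'm \<Rightarrow> real" where
  "swapped_pvalue b T u j k v =
    gc_pvalue (\<lambda>i. b (Transposition.transpose (Inr j) k (Inl i)))
      (\<chi> i. T $ Transposition.transpose (Inr j) k i) (u(j := v))"

text \<open>The \<open>1\<close> in front of the tie count of \<open>gc_pvalue\<close> stands for
  \<open>k\<close> itself, which is miscovered and tied with itself. The numerator is thus the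
  smoothed rank of \<open>k\<close> among all miscovered slots, as in
  \<open>sum_smoothed_rank_le\<close>.\<close>

lemma swapped_pvalue_self:
  fixes T :: "real^('n::finite + 'm::finite)"
  assumes k: "k \<in> slots j" "b k"
  shows "swapped_pvalue b T u j k v j =
    ((\<Sum>i\<in>{i\<in>slots j. b i}. of_bool (T $ i > T $ k)) +
     (\<Sum>i\<in>{i\<in>slots j. b i}. of_bool (T $ i = T $ k)) * v) / (real CARD('n) + 1)"
proof -
  have Collect: "(\<Sum>i\<in>{i\<in>slots j. b i}. of_bool (P i)) = (\<Sum>i\<in>slots j. of_bool (b i \<and> P i))"
    for P :: "'n + 'm \<Rightarrow> bool"
    by (simp add: sum.inter_filter of_bool_conj) (intro sum.cong, auto)
  show ?thesis
    unfolding Collect swapped_pvalue_def gc_pvalue_def vec_lambda_beta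
      sum_swapped_calibration[OF k(1), of "\<lambda>i. of_bool (b i \<and> T $ i > c)" for c]
      sum_swapped_calibration[OF k(1), of "\<lambda>i. of_bool (b i \<and> T $ i = c)" for c]
    using k by simp
qed

text \<open>The sums over all slots are the same for every \<open>k\<close>, so the dependence on
  \<open>k\<close> is confined to the two subtracted indicators, and \<open>v\<close> has dropped
  out.\<close>

lemma swapped_pvalue_other:
  fixes T :: "real^('n::finite + 'm::finite)"
  assumes k: "k \<in> slots j" "b k" and l: "l \<noteq> j"
  shows "swapped_pvalue b T u j k v l =
    ((\<Sum>i\<in>slots j. of_bool (b i \<and> T $ i > T $ Inr l)) - of_bool (T $ k > T $ Inr l) +
     (1 + (\<Sum>i\<in>slots j. of_bool (b i \<and> T $ i = T $ Inr l)) - of_bool (T $ k = T $ Inr l)) * u l)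
    / (real CARD('n) + 1)"
proof -
  have "Transposition.transpose (Inr j) k (Inr l) = Inr l"
    using k(1) l by (auto simp: slots_def)
  then show ?thesis
    unfolding swapped_pvalue_def gc_pvalue_def vec_lambda_beta
      sum_swapped_calibration[OF k(1), of "\<lambda>i. of_bool (b i \<and> T $ i > c)" for c]
      sum_swapped_calibration[OF k(1), of "\<lambda>i. of_bool (b i \<and> T $ i = c)" for c]
    using k l by (simp add: algebra_simps)
qed

text \<open>A smaller p-value of \<open>j\<close> forces a score of \<open>k\<close> at least as
  high as that of \<open>k'\<close>. Taking the higher-scoring point out of the calibration set
  lowers every other p-value by at least as much.\<close>

lemma swapped_pvalue_mono:
  fixes T :: "real^('n::finite + 'm::finite)"
  assumes k: "k \<in> slots j" "b k" "0 < v" and k': "k' \<in> slots j" "b k'" "v' < 1"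
    and le: "swapped_pvalue b T u j k v j \<le> swapped_pvalue b T u j k' v' j"
    and u: "\<And>l. 0 \<le> u l" "\<And>l. u l \<le> 1"
  shows "swapped_pvalue b T u j k v l \<le> swapped_pvalue b T u j k' v' l"
proof (cases "l = j")
  case True
  with le show ?thesis by simp
next
  case l: False
  define K where "K = {i\<in>slots j. b i}"
  define G where "G c = (\<Sum>i\<in>K. of_bool (T $ i > T $ c) :: real)" for c
  define E where "E c = (\<Sum>i\<in>K. of_bool (T $ i = T $ c) :: real)" for c
  have E_pos: "E c > 0" if "c \<in> K" for c
  proof -
    have "(1::real) = (\<Sum>i\<in>{c}. of_bool (T $ i = T $ c))" by simp
    also have "\<dots> \<le> E c" unfolding E_def using that by (intro sum_mono2) (auto simp: K_def)
    finally show ?thesis by simp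
  qed
  \<comment> \<open>If \<open>k\<close> scored below \<open>k'\<close>, all points at or above the
    level of \<open>k'\<close> would lie strictly above \<open>k\<close>. The rank interval of
    \<open>k\<close> would then start no earlier than that of \<open>k'\<close> ends, and
    \<open>0 < v\<close>, \<open>v' < 1\<close> make the order of the p-values strict in the wrong
    direction.\<close>
  have Tk: "T $ k \<ge> T $ k'"
  proof (rule ccontr)
    assume "\<not> T $ k \<ge> T $ k'"
    then have "G k' + E k' \<le> G k"
      unfolding G_def E_def sum.distrib[symmetric] by (intro sum_mono) (auto simp: of_bool_def)
    moreover have "E k' * v' < E k' * 1" using k' E_pos by (intro mult_strict_left_mono) (auto simp: K_def)
    moreover have "0 < E k * v" using k E_pos by (simp add: K_def)
    moreover have "G k + E k * v \<le> G k' + E k' * v'"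
      using le unfolding swapped_pvalue_self[where b = b, OF k(1,2)] swapped_pvalue_self[where b = b, OF k'(1,2)]
      by (simp add: G_def E_def K_def divide_le_cancel)
    ultimately show False by linarith
  qed
  \<comment> \<open>\<open>r c\<close> is what a miscovered point \<open>c\<close> adds to the
    numerator for \<open>l\<close> from a calibration position, hence what is lost when it moves to
    position \<open>j\<close>. It takes the values 0, \<open>u l\<close>, 1 as the score of
    \<open>c\<close> rises past that of \<open>l\<close>.\<close>
  define r :: "'n + 'm \<Rightarrow> real"
    where "r c = of_bool (T $ c > T $ Inr l) + of_bool (T $ c = T $ Inr l) * u l" for c
  have "r k' \<le> r k" using Tk u[of l] by (auto simp: r_def of_bool_def)
  then show ?thesis
    unfolding swapped_pvalue_other[where b = b, OF k(1,2) l] swapped_pvalue_other[where b = b, OF k'(1,2) l]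
    by (intro divide_right_mono) (auto simp: r_def algebra_simps)
qed

section \<open>The share of one test point, averaged over its exchanges\<close>

lemma emeasure_uniform_unit_interval:
  fixes H :: "real set"
  assumes H: "H \<in> sets borel" "H \<subseteq> {0<..<1}"
  shows "emeasure (uniform_measure lborel {0<..<1}) H = ennreal (measure lborel H)"
proof -
  have "emeasure lborel H \<le> emeasure lborel {0<..<1::real}"
    using H by (intro emeasure_mono) auto
  then have "emeasure lborel H \<noteq> \<infinity>"
    by (auto simp: top_unique)
  moreover have "{0<..<1} \<inter> H = H" using H by auto
  ultimately show ?thesis
    using H by (simp add: emeasure_eq_ennreal_measure divide_ennreal_def)
qed

text \<open>
  The restriction to \<open>0 < u l < 1\<close> costs nothing almost surely; it is what \<open>swapped_pvalue_mono\<close> needs.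
\<close>

definition false_selection_share ::
    "real \<Rightarrow> ('n::finite + 'm::finite \<Rightarrow> bool) \<Rightarrow> real^('n + 'm) \<Rightarrow> ('m \<Rightarrow> real) \<Rightarrow> 'm \<Rightarrow> real" where
  "false_selection_share \<alpha> b T u j =
    (let S = scip_selection \<alpha> (\<lambda>i. b (Inl i)) T u
     in of_bool (b (Inr j) \<and> j \<in> S \<and> (\<forall>l. 0 < u l \<and> u l < 1)) / real (max 1 (card S)))"

text \<open>Data and other randomisers are fixed, so only \<open>k\<close> and \<open>v\<close>
  vary. The least count \<open>r\<close> cancels: it enters the bound on the mass as a factor and
  the bound on the share as a divisor. The factor n + 1 is the denominator of the p-value.\<close>

lemma sum_false_selection_share_le:
  fixes T :: "real^('n::finite + 'm::finite)" and u :: "'m \<Rightarrow> real"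
  assumes \<alpha>: "0 \<le> \<alpha>" "\<alpha> \<le> 1"
  shows "(\<Sum>k\<in>slots j. \<integral>\<^sup>+v. ennreal (false_selection_share \<alpha>
      (\<lambda>i. b (Transposition.transpose (Inr j) k i)) (\<chi> i. T $ Transposition.transpose (Inr j) k i)
      (u(j := v)) j) \<partial>uniform_measure lborel {0<..<1})
    \<le> ennreal ((real CARD('n) + 1) * \<alpha> / real CARD('m))"
proof -
  let ?unif = "uniform_measure lborel {0<..<1::real}"
  let ?m = "real CARD('m)" and ?n = "real CARD('n) + 1"
  define K where "K = {i\<in>slots j. b i}"
  define p where "p = swapped_pvalue b T u j"
  define R where "R k v = bh_count \<alpha> (p k v)" for k v
  define f where "f k v = false_selection_share \<alpha>
      (\<lambda>i. b (Transposition.transpose (Inr j) k i)) (\<chi> i. T $ Transposition.transpose (Inr j) k i)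
      (u(j := v)) j" for k v
  define A where "A = {(k, v). k \<in> K \<and> 0 < v \<and> v < 1 \<and> (\<forall>l. l \<noteq> j \<longrightarrow> 0 < u l \<and> u l < 1) \<and>
      p k v j \<le> \<alpha> * real (R k v) / ?m}"
  \<comment> \<open>Both membership of \<open>j\<close> in the selection and the size of the
    selection are expressed through \<open>R k v\<close>, which makes the antitonicity of
    \<open>bh_count\<close> applicable.\<close>
  have f: "f k v = of_bool ((k, v) \<in> A) / real (max 1 (R k v))" if "k \<in> slots j" for k v
  proof -
    have sel: "scip_selection \<alpha> (\<lambda>i. b (Transposition.transpose (Inr j) k (Inl i)))
        (\<chi> i. T $ Transposition.transpose (Inr j) k i) (u(j := v)) =
        {l. p k v l \<le> \<alpha> * real (R k v) / ?m}"
      unfolding scip_selection_def p_def R_def scip_threshold_eq[OF \<alpha>] by (simp add: swapped_pvalue_def)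
    have card: "card {l. p k v l \<le> \<alpha> * real (R k v) / ?m} = R k v"
      unfolding R_def scip_threshold_eq[OF \<alpha>, symmetric] by (rule card_le_scip_threshold[OF \<alpha>])
    show ?thesis
      unfolding f_def false_selection_share_def Let_def sel card
      using that by (auto simp: A_def K_def of_bool_def)
  qed
  show ?thesis
  proof (cases "A = {}")
    case True
    then have "(\<Sum>k\<in>slots j. \<integral>\<^sup>+v. ennreal (f k v) \<partial>?unif) = 0"
      by (simp add: f)
    then show ?thesis by (simp add: f_def)
  next
    case False
    define r where "r = Min ((\<lambda>(k, v). R k v) ` A)"
    have fin: "finite ((\<lambda>(k, v). R k v) ` A)"
      by (rule finite_subset[of _ "{..CARD('m)}"]) (auto simp: R_def bh_count_in)
    have "r \<in> (\<lambda>(k, v). R k v) ` A"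
      unfolding r_def using fin False by (intro Min_in) auto
    then obtain k0 v0 where A0: "(k0, v0) \<in> A" and r0: "R k0 v0 = r" by auto
    have r_le: "r \<le> R k v" if "(k, v) \<in> A" for k v
      unfolding r_def using fin that by (intro Min_le) force+
    \<comment> \<open>At the minimiser \<open>j\<close> itself is selected, so the count there is
      not 0 and division by \<open>r\<close> is meaningful.\<close>
    have r_pos: "r > 0"
    proof -
      have "j \<in> {l. p k0 v0 l \<le> scip_threshold \<alpha> (p k0 v0)}"
        using A0 by (simp add: A_def R_def scip_threshold_eq[OF \<alpha>])
      then have "card {l. p k0 v0 l \<le> scip_threshold \<alpha> (p k0 v0)} > 0"
        by (subst card_gt_0_iff) auto
      then show ?thesis using r0 by (simp add: card_le_scip_threshold[OF \<alpha>] R_def)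
    qed
    \<comment> \<open>The p-value bound \<alpha> r / m, multiplied by the denominator n + 1, becomes
      a bound on the smoothed rank.\<close>
    define x where "x = ?n * (\<alpha> * real r / ?m)"
    have x: "0 \<le> x" using \<alpha> by (simp add: x_def)
    let ?H = "\<lambda>k. {v\<in>{0<..<1}. (\<Sum>i\<in>K. of_bool (T $ i > T $ k)) + (\<Sum>i\<in>K. of_bool (T $ i = T $ k)) * v \<le> x}"
    have p_le: "p k v j \<le> \<alpha> * real r / ?m" if kv: "(k, v) \<in> A" for k v
    proof (cases "R k v = r")
      case True
      with kv show ?thesis by (simp add: A_def)
    next
      case False
      \<comment> \<open>A larger p-value of \<open>j\<close> than at the minimiser would make all
        p-values at least as large, hence the count at most \<open>r\<close>; this case has a count
        different from \<open>r\<close>.\<close>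
      have "p k v j \<le> p k0 v0 j"
      proof (rule ccontr)
        assume "\<not> p k v j \<le> p k0 v0 j"
        \<comment> \<open>\<open>A\<close> bounds \<open>u l\<close> only for \<open>l\<close> other
          than \<open>j\<close>. Since \<open>swapped_pvalue\<close> overwrites \<open>u j\<close>
          by \<open>v\<close>, the dummy value 1/2 supplies the missing bound without changing
          anything.\<close>
        moreover have "0 \<le> (u(j := 1/2)) l" "(u(j := 1/2)) l \<le> 1" for l
          using kv by (auto simp: A_def less_imp_le)
        moreover have "swapped_pvalue b T (u(j := 1/2)) j = swapped_pvalue b T u j"
          by (intro ext) (simp add: swapped_pvalue_def)
        ultimately have "p k0 v0 l \<le> p k v l" for l
          using A0 kv swapped_pvalue_mono[of k0 j b v0 k v T "u(j := 1/2)" l]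
          by (auto simp: A_def p_def K_def)
        then have "R k v \<le> r"
          unfolding r0[symmetric] R_def by (rule bh_count_antimono)
        with r_le[OF kv] False show False by simp
      qed
      also have "\<dots> \<le> \<alpha> * real r / ?m" using A0 r0 by (simp add: A_def)
      finally show ?thesis .
    qed
    have f_le: "f k v \<le> of_bool (b k) / real r * indicator (?H k) v" if k: "k \<in> slots j" for k v
    proof (cases "(k, v) \<in> A")
      case True
      then have kb: "b k" and v: "0 < v" "v < 1" by (auto simp: A_def K_def)
      have "v \<in> ?H k"
        using p_le[OF True] v unfolding p_def swapped_pvalue_self[where b = b, OF k kb]
        by (simp add: x_def K_def pos_divide_le_eq mult.commute)
      moreover have "1 / real (max 1 (R k v)) \<le> 1 / real r"
        using r_le[OF True] r_pos by (intro divide_left_mono) auto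
      ultimately show ?thesis using True kb by (simp add: f[OF k])
    next
      case False
      then show ?thesis by (simp add: f[OF k])
    qed
    have H[measurable]: "?H k \<in> sets borel" for k by measurable
    have unif_H: "emeasure ?unif (?H k) = ennreal (measure lborel (?H k))" for k
      by (rule emeasure_uniform_unit_interval) auto
    have "(\<Sum>k\<in>slots j. \<integral>\<^sup>+v. ennreal (f k v) \<partial>?unif) \<le>
        (\<Sum>k\<in>slots j. ennreal (of_bool (b k) / real r * measure lborel (?H k)))"
    proof (rule sum_mono)
      fix k :: "'n + 'm" assume k: "k \<in> slots j"
      have "(\<integral>\<^sup>+v. ennreal (f k v) \<partial>?unif) \<le>
          (\<integral>\<^sup>+v. ennreal (of_bool (b k) / real r) * indicator (?H k) v \<partial>?unif)"
        using f_le[OF k]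
        by (intro nn_integral_mono) (simp add: ennreal_mult'[symmetric] ennreal_indicator[symmetric] ennreal_leI)
      also have "\<dots> = ennreal (of_bool (b k) / real r) * ennreal (measure lborel (?H k))"
        using unif_H by (subst nn_integral_cmult_indicator) simp_all
      also have "\<dots> = ennreal (of_bool (b k) / real r * measure lborel (?H k))"
        by (rule ennreal_mult[symmetric]) auto
      finally show "(\<integral>\<^sup>+v. ennreal (f k v) \<partial>?unif) \<le>
          ennreal (of_bool (b k) / real r * measure lborel (?H k))" .
    qed
    also have "\<dots> = ennreal (\<Sum>k\<in>slots j. of_bool (b k) / real r * measure lborel (?H k))"
      by (rule sum_ennreal) simp
    also have "(\<Sum>k\<in>slots j. of_bool (b k) / real r * measure lborel (?H k)) =
        (\<Sum>k\<in>K. measure lborel (?H k)) / real r"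
      unfolding K_def sum_divide_distrib
      by (simp add: sum.inter_filter) (intro sum.cong, auto)
    also have "ennreal \<dots> \<le> ennreal (x / real r)"
      using r_pos x by (intro ennreal_leI divide_right_mono sum_smoothed_rank_le) (auto simp: K_def)
    also have "x / real r = ?n * \<alpha> / ?m" using r_pos by (simp add: x_def)
    finally show ?thesis by (simp add: f_def)
  qed
qed

subsection \<open>The diversity-aware scores\<close>

text \<open>
  Unlike \<open>matrix_inv\<close>, Cramer's rule is measurable and permutation equivariant for singular matrices as
  well, where \<open>x / 0 = 0\<close> makes it zero.
\<close>

definition cramer_solve :: "real^'k^'k \<Rightarrow> real^'k \<Rightarrow> real^'k" where
  "cramer_solve A b = (\<chi> k. det (\<chi> i j. if j = k then b $ i else A $ i $ j) / det A)"

lemma matrix_inv_mult_eq_cramer_solve: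
  assumes "det A \<noteq> 0"
  shows "matrix_inv A *v b = cramer_solve A b"
proof -
  have "invertible A" using assms by (simp add: invertible_det_nz)
  then have "A ** matrix_inv A = mat 1"
    unfolding matrix_inv_def invertible_def by (rule someI2_ex) simp
  then have "A *v (matrix_inv A *v b) = b"
    by (simp add: matrix_vector_mul_assoc)
  then show ?thesis
    unfolding cramer[OF assms] cramer_solve_def .
qed

text \<open>Permuting rows and columns alike multiplies the determinant by the square of the sign,
  which is 1. If it is nonzero, the relabelled solution solves the relabelled system and Cramer's
  rule identifies it; if it is zero, both sides vanish by \<open>x / 0 = 0\<close>.\<close>

lemma cramer_solve_permute:
  fixes A :: "real^'k^'k"
  assumes \<sigma>: "\<sigma> permutes UNIV"
  shows "cramer_solve (\<chi> i j. A $ \<sigma> i $ \<sigma> j) (\<chi> i. b $ \<sigma> i) = (\<chi> i. cramer_solve A b $ \<sigma> i)"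
proof -
  have "det (\<chi> i j. A $ \<sigma> i $ \<sigma> j) = of_int (sign \<sigma>) * det (\<chi> i. A $ \<sigma> i)"
    using det_permute_columns[OF \<sigma>, of "\<chi> i. A $ \<sigma> i"] by simp
  also have "\<dots> = (of_int (sign \<sigma>) * of_int (sign \<sigma>)) * det A"
    by (simp add: det_permute_rows[OF \<sigma>])
  also have "of_int (sign \<sigma>) * of_int (sign \<sigma>) = (1::real)"
    by (simp add: sign_def)
  finally have det: "det (\<chi> i j. A $ \<sigma> i $ \<sigma> j) = det A" by simp
  show ?thesis
  proof (cases "det A = 0")
    case True
    then show ?thesis by (simp add: cramer_solve_def det vec_eq_iff)
  next
    case False
    define x where "x = cramer_solve A b"
    have "A *v x = b"
      using cramer[OF False, of x b] by (simp add: x_def cramer_solve_def)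
    then have b: "(\<Sum>j\<in>UNIV. A $ i $ j * x $ j) = b $ i" for i
      by (auto simp: matrix_vector_mult_def)
    have "(\<Sum>j\<in>UNIV. A $ \<sigma> i $ \<sigma> j * x $ \<sigma> j) = b $ \<sigma> i" for i
      using sum.permute[OF \<sigma>, of "\<lambda>j. A $ \<sigma> i $ j * x $ j"] by (simp add: b comp_def)
    then have "(\<chi> i j. A $ \<sigma> i $ \<sigma> j) *v (\<chi> i. x $ \<sigma> i) = (\<chi> i. b $ \<sigma> i)"
      by (simp add: matrix_vector_mult_def)
    then show ?thesis
      using cramer[of "\<chi> i j. A $ \<sigma> i $ \<sigma> j" "\<chi> i. x $ \<sigma> i" "\<chi> i. b $ \<sigma> i"] False
      unfolding det by (simp add: x_def[symmetric]) (simp add: cramer_solve_def det)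
  qed
qed

lemma inner_permute:
  fixes x y :: "real^'k"
  assumes "\<sigma> permutes UNIV"
  shows "(\<chi> i. x $ \<sigma> i) \<bullet> (\<chi> i. y $ \<sigma> i) = x \<bullet> y"
  using sum.permute[OF assms, of "\<lambda>i. x $ i * y $ i"] by (simp add: inner_vec_def comp_def)

lemma det_positive_definite_nonzero:
  assumes "positive_definite A"
  shows "det A \<noteq> 0"
    unfolding invertible_det_nz[symmetric] invertible_left_inverse matrix_left_invertible_ker
  using assms by (force simp: positive_definite_def)

text \<open>A substitute for \<open>diversity_scores\<close> whose equivariance and measurability
  need no positive definiteness; the two agree wherever the matrix is positive definite.\<close>

definition cramer_scores ::
    "real \<Rightarrow> ('x \<Rightarrow> 'x \<Rightarrow> real) \<Rightarrow> (('k \<Rightarrow> 'x \<times> 'y) \<Rightarrow> 'd \<Rightarrow> 'x \<Rightarrow> real) \<Rightarrow>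
     ('k \<Rightarrow> 'x \<times> 'y) \<Rightarrow> 'd \<Rightarrow> real^'k" where
  "cramer_scores \<alpha> s \<psi> z d =
    (let \<Psi> = psi_vec \<psi> z d;
         one = (\<chi> i. 1);
         A = diversity_matrix s \<psi> z d;
         u1 = \<Psi> \<bullet> cramer_solve A \<Psi>;
         u2 = \<Psi> \<bullet> cramer_solve A one;
         u3 = one \<bullet> cramer_solve A one
     in cramer_solve A ((\<alpha> * u2 - u1) *\<^sub>R \<Psi> + (u2 - \<alpha> * u3) *\<^sub>R one))"

lemma diversity_scores_eq_cramer_scores:
  assumes "positive_definite (diversity_matrix s \<psi> z d)"
  shows "diversity_scores \<alpha> s \<psi> z d = cramer_scores \<alpha> s \<psi> z d"
  unfolding diversity_scores_def cramer_scores_def Let_def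
    matrix_inv_mult_eq_cramer_solve[OF det_positive_definite_nonzero[OF assms]] ..

text \<open>The inner products \<open>u1\<close>, \<open>u2\<close>, \<open>u3\<close> do not change
  under a common relabelling, so the coefficients stay the same and only the outer solution vector
  is relabelled.\<close>

lemma cramer_scores_permute:
  assumes \<sigma>: "\<sigma> permutes (UNIV :: 'k::finite set)"
    and \<psi>: "\<And>i. \<psi> (\<lambda>i. z (\<sigma> i)) d (fst (z i)) = \<psi> z d (fst (z i))"
  shows "cramer_scores \<alpha> s \<psi> (\<lambda>i. z (\<sigma> i)) d = (\<chi> i. cramer_scores \<alpha> s \<psi> z d $ \<sigma> i)"
proof -
  define \<Psi> where "\<Psi> = psi_vec \<psi> z d"
  define A where "A = diversity_matrix s \<psi> z d"
  define one :: "real^'k" where "one = (\<chi> i. 1)"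
  have \<Psi>: "psi_vec \<psi> (\<lambda>i. z (\<sigma> i)) d = (\<chi> i. \<Psi> $ \<sigma> i)"
    by (simp add: psi_vec_def \<Psi>_def \<psi>)
  have A: "diversity_matrix s \<psi> (\<lambda>i. z (\<sigma> i)) d = (\<chi> i j. A $ \<sigma> i $ \<sigma> j)"
    by (simp add: diversity_matrix_def A_def \<Psi>) (simp add: \<Psi>_def)
  have one: "(\<chi> i. 1) = (\<chi> i. one $ \<sigma> i)"
    by (simp add: one_def)
  have lin: "a *\<^sub>R (\<chi> i. x $ \<sigma> i) + c *\<^sub>R (\<chi> i. y $ \<sigma> i) = (\<chi> i. (a *\<^sub>R x + c *\<^sub>R y) $ \<sigma> i)"
    for a c and x y :: "real^'k"
    by (simp add: vec_eq_iff)
  have "cramer_scores \<alpha> s \<psi> (\<lambda>i. z (\<sigma> i)) d = (\<chi> i. (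
    let u1 = \<Psi> \<bullet> cramer_solve A \<Psi>;
         u2 = \<Psi> \<bullet> cramer_solve A one;
         u3 = one \<bullet> cramer_solve A one
     in cramer_solve A ((\<alpha> * u2 - u1) *\<^sub>R \<Psi> + (u2 - \<alpha> * u3) *\<^sub>R one)) $ \<sigma> i)"
    unfolding cramer_scores_def \<Psi> A one Let_def cramer_solve_permute[OF \<sigma>] inner_permute[OF \<sigma>] lin ..
  then show ?thesis
    by (simp add: cramer_scores_def \<Psi>_def A_def one_def Let_def)
qed

lemma cramer_solve_measurable:
  assumes [measurable]: "\<And>i j. (\<lambda>x. A x $ i $ j) \<in> borel_measurable N"
    "\<And>i. (\<lambda>x. b x $ i) \<in> borel_measurable N"
  shows "(\<lambda>x. cramer_solve (A x) (b x) $ k) \<in> borel_measurable N"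
proof -
  have [measurable]: "(\<lambda>x. (if q then b x $ i else A x $ i $ j)) \<in> borel_measurable N" for q i j
    by (cases q) simp_all
  show ?thesis
    unfolding cramer_solve_def det_def vec_lambda_beta by measurable
qed

lemma cramer_scores_measurable:
  fixes \<psi> :: "('k::finite \<Rightarrow> 'x \<times> 'y) \<Rightarrow> 'd \<Rightarrow> 'x \<Rightarrow> real"
  assumes \<psi>: "(\<lambda>(x, (z, d)). \<psi> z d x) \<in>
      borel_measurable (MX \<Otimes>\<^sub>M (Pi\<^sub>M UNIV (\<lambda>_. MX \<Otimes>\<^sub>M MY) \<Otimes>\<^sub>M MD))"
    and s: "(\<lambda>(x, x'). s x x') \<in> borel_measurable (MX \<Otimes>\<^sub>M MX)"
  shows "(\<lambda>(z, d). cramer_scores \<alpha> s \<psi> z d $ k) \<in>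
      borel_measurable (Pi\<^sub>M UNIV (\<lambda>_. MX \<Otimes>\<^sub>M MY) \<Otimes>\<^sub>M MD)"
proof -
  let ?N = "Pi\<^sub>M UNIV (\<lambda>_. MX \<Otimes>\<^sub>M MY) \<Otimes>\<^sub>M MD :: (('k \<Rightarrow> 'x \<times> 'y) \<times> 'd) measure"
  have fst_z[measurable]: "(\<lambda>w. fst (fst w i)) \<in> ?N \<rightarrow>\<^sub>M MX" for i
    by measurable
  have "(\<lambda>w. (fst (fst w i), w)) \<in> ?N \<rightarrow>\<^sub>M MX \<Otimes>\<^sub>M ?N" for i
    by measurable
  from measurable_compose[OF this \<psi>]
  have [measurable]: "(\<lambda>w. psi_vec \<psi> (fst w) (snd w) $ i) \<in> borel_measurable ?N" for i
    by (simp add: psi_vec_def case_prod_beta)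
  have "(\<lambda>w. (fst (fst w i), fst (fst w j))) \<in> ?N \<rightarrow>\<^sub>M MX \<Otimes>\<^sub>M MX" for i j
    by measurable
  from measurable_compose[OF this s]
  have [measurable]: "(\<lambda>w. s (fst (fst w i)) (fst (fst w j))) \<in> borel_measurable ?N" for i j
    by simp
  have [measurable]: "(\<lambda>w. diversity_matrix s \<psi> (fst w) (snd w) $ i $ j) \<in> borel_measurable ?N" for i j
    unfolding diversity_matrix_def vec_lambda_beta by measurable
  note [measurable] = cramer_solve_measurable
  show ?thesis
    unfolding cramer_scores_def Let_def case_prod_beta inner_vec_def inner_real_def
    by (intro cramer_solve_measurable) (simp_all, measurable)
qed

subsection \<open>Exchangeability and the expected false selection share\<close>

text \<open>Integrating the almost sure equality of conditional probabilities over the event that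
  \<open>D\<close> lies in \<open>B\<close> gives equal probabilities on all rectangles. These form
  an intersection-stable generator of the product sigma-algebra.\<close>

lemma cond_exchangeable_distr_eq:
  fixes Z :: "'k::finite \<Rightarrow> 'a \<Rightarrow> 'z"
  assumes "prob_space M"
    and Z[measurable]: "\<And>i. Z i \<in> M \<rightarrow>\<^sub>M N"
    and D[measurable]: "D \<in> M \<rightarrow>\<^sub>M MD"
    and exch: "cond_exchangeable M N Z MD D"
    and \<sigma>: "\<sigma> permutes UNIV"
  shows "distr M (Pi\<^sub>M UNIV (\<lambda>_. N) \<Otimes>\<^sub>M MD) (\<lambda>\<omega>. (\<lambda>i. Z (\<sigma> i) \<omega>, D \<omega>)) =
    distr M (Pi\<^sub>M UNIV (\<lambda>_. N) \<Otimes>\<^sub>M MD) (\<lambda>\<omega>. (\<lambda>i. Z i \<omega>, D \<omega>))"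
proof -
  interpret prob_space M by fact
  let ?P = "Pi\<^sub>M UNIV (\<lambda>_. N) :: ('k \<Rightarrow> 'z) measure"
  let ?F = "vimage_algebra (space M) D MD"
  have Dspace: "D \<in> space M \<rightarrow> space MD" using D by (auto simp: measurable_def)
  have "subalgebra M ?F"
    unfolding subalgebra_def
    by (auto simp: sets_vimage_algebra2[OF Dspace] measurable_sets[OF D])
  then interpret finite_measure_subalgebra M ?F
    by unfold_locales
  have Zv[measurable]: "(\<lambda>\<omega> i. Z (\<tau> i) \<omega>) \<in> M \<rightarrow>\<^sub>M ?P" for \<tau> :: "'k \<Rightarrow> 'k"
    by (rule measurable_PiM_single') (auto simp: Pi_iff space_PiM measurable_space[OF Z])
  have rect: "measure M {\<omega>\<in>space M. (\<lambda>i. Z (\<tau> i) \<omega>) \<in> A \<and> D \<omega> \<in> B} =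
      (LINT \<omega>:(D -` B \<inter> space M)|M. cond_prob_given M MD D {\<omega>'\<in>space M. (\<lambda>i. Z (\<tau> i) \<omega>') \<in> A} \<omega>)"
    if A[measurable]: "A \<in> sets ?P" and B[measurable]: "B \<in> sets MD" for A B and \<tau> :: "'k \<Rightarrow> 'k"
  proof -
    let ?E = "{\<omega>'\<in>space M. (\<lambda>i. Z (\<tau> i) \<omega>') \<in> A}"
    have E: "?E \<in> sets M" by measurable
    have "(LINT \<omega>:(D -` B \<inter> space M)|M. cond_prob_given M MD D ?E \<omega>) =
        (LINT \<omega>:(D -` B \<inter> space M)|M. indicator ?E \<omega>)"
      unfolding cond_prob_given_def
      by (rule real_cond_exp_intA[symmetric])
        (use E B in \<open>auto intro!: in_vimage_algebra simp: emeasure_eq_measure\<close>)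
    also have "\<dots> = measure M {\<omega>\<in>space M. (\<lambda>i. Z (\<tau> i) \<omega>) \<in> A \<and> D \<omega> \<in> B}"
    proof -
      have "(\<lambda>\<omega>. indicator (D -` B \<inter> space M) \<omega> *\<^sub>R indicator ?E \<omega>) =
          (indicator {\<omega>\<in>space M. (\<lambda>i. Z (\<tau> i) \<omega>) \<in> A \<and> D \<omega> \<in> B} :: _ \<Rightarrow> real)"
        by (auto simp: fun_eq_iff indicator_def)
      then show ?thesis
        unfolding set_lebesgue_integral_def by (simp add: Int_def conj_commute cong: conj_cong)
    qed
    finally show ?thesis ..
  qed
  have eq: "measure M {\<omega>\<in>space M. (\<lambda>i. Z (\<sigma> i) \<omega>) \<in> A \<and> D \<omega> \<in> B} =
      measure M {\<omega>\<in>space M. (\<lambda>i. Z i \<omega>) \<in> A \<and> D \<omega> \<in> B}"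
    if A: "A \<in> sets ?P" and B: "B \<in> sets MD" for A B
  proof -
    have "AE \<omega> in M. cond_prob_given M MD D {\<omega>'\<in>space M. (\<lambda>i. Z (\<sigma> i) \<omega>') \<in> A} \<omega> =
        cond_prob_given M MD D {\<omega>'\<in>space M. (\<lambda>i. Z i \<omega>') \<in> A} \<omega>"
      using exch \<sigma> A by (auto simp: cond_exchangeable_def)
    moreover have "cond_prob_given M MD D E \<in> borel_measurable M" for E
      unfolding cond_prob_given_def by simp
    moreover have "D -` B \<inter> space M \<in> sets M" using B by measurable
    ultimately show ?thesis
      unfolding rect[OF A B] rect[OF A B, of "\<lambda>i. i"] set_lebesgue_integral_def
      by (intro integral_cong_AE) auto
  qed
  let ?E = "{a \<times> b | a b. a \<in> sets ?P \<and> b \<in> sets MD}"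
  show ?thesis
  proof (rule measure_eqI_generator_eq[OF Int_stable_pair_measure_generator[of ?P MD],
        of "space ?P \<times> space MD" _ _ "\<lambda>_. space ?P \<times> space MD"])
    show "?E \<subseteq> Pow (space ?P \<times> space MD)"
      by (auto dest: sets.sets_into_space)
    fix X assume "X \<in> ?E"
    then obtain A B where X: "X = A \<times> B" and A[measurable]: "A \<in> sets ?P" and B[measurable]: "B \<in> sets MD"
      by auto
    have "emeasure (distr M (?P \<Otimes>\<^sub>M MD) (\<lambda>\<omega>. (\<lambda>i. Z (\<tau> i) \<omega>, D \<omega>))) X =
        ennreal (measure M {\<omega>\<in>space M. (\<lambda>i. Z (\<tau> i) \<omega>) \<in> A \<and> D \<omega> \<in> B})" for \<tau> :: "'k \<Rightarrow> 'k"
      unfolding X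
      by (subst emeasure_distr) (auto simp: emeasure_eq_measure intro!: arg_cong[where f="measure M"])
    from this[of \<sigma>] this[of "\<lambda>i. i"]
    show "emeasure (distr M (?P \<Otimes>\<^sub>M MD) (\<lambda>\<omega>. (\<lambda>i. Z (\<sigma> i) \<omega>, D \<omega>))) X =
        emeasure (distr M (?P \<Otimes>\<^sub>M MD) (\<lambda>\<omega>. (\<lambda>i. Z i \<omega>, D \<omega>))) X"
      by (simp add: eq[OF A B])
  next
    have "prob_space (distr M (?P \<Otimes>\<^sub>M MD) (\<lambda>\<omega>. (\<lambda>i. Z (\<sigma> i) \<omega>, D \<omega>)))"
      by (rule prob_space_distr) measurable
    then show "emeasure (distr M (?P \<Otimes>\<^sub>M MD) (\<lambda>\<omega>. (\<lambda>i. Z (\<sigma> i) \<omega>, D \<omega>))) (space ?P \<times> space MD) \<noteq> \<infinity>"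
      using finite_measure.emeasure_finite[OF prob_space.finite_measure] by fastforce
  qed (auto simp: sets_pair_measure)
qed

text \<open>Project the invariant joint law of the points and \<open>D\<close> onto the
  points.\<close>

lemma cond_exchangeable_imp_exchangeable:
  fixes Z :: "'k::finite \<Rightarrow> 'a \<Rightarrow> 'z"
  assumes "prob_space M"
    and Z[measurable]: "\<And>i. Z i \<in> M \<rightarrow>\<^sub>M N"
    and D[measurable]: "D \<in> M \<rightarrow>\<^sub>M MD"
    and exch: "cond_exchangeable M N Z MD D"
  shows "exchangeable M N Z"
  unfolding exchangeable_def
proof (intro allI impI)
  fix \<sigma> :: "'k \<Rightarrow> 'k" assume \<sigma>: "\<sigma> permutes UNIV"
  let ?P = "Pi\<^sub>M UNIV (\<lambda>_. N) :: ('k \<Rightarrow> 'z) measure"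
  have Zv[measurable]: "(\<lambda>\<omega> i. Z (\<tau> i) \<omega>) \<in> M \<rightarrow>\<^sub>M ?P" for \<tau> :: "'k \<Rightarrow> 'k"
    by (rule measurable_PiM_single') (auto simp: Pi_iff space_PiM measurable_space[OF Z])
  have "distr M ?P (\<lambda>\<omega> i. Z (\<tau> i) \<omega>) =
      distr (distr M (?P \<Otimes>\<^sub>M MD) (\<lambda>\<omega>. (\<lambda>i. Z (\<tau> i) \<omega>, D \<omega>))) ?P fst" for \<tau> :: "'k \<Rightarrow> 'k"
    by (subst distr_distr) (auto simp: comp_def)
  from this[of \<sigma>] this[of "\<lambda>i. i"]
  show "distr M ?P (\<lambda>\<omega> i. Z (\<sigma> i) \<omega>) = distr M ?P (\<lambda>\<omega> i. Z i \<omega>)"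
    by (simp add: cond_exchangeable_distr_eq[OF assms \<sigma>])
qed

text \<open>Events of \<open>h\<close> applied to \<open>Y\<close> are events of \<open>Y\<close>,
  so the joint law factorises on rectangles. The map \<open>h\<close> serves to forget the training
  data, which the independence assumption includes.\<close>

lemma (in prob_space) indep_set_vimage_distr_pair:
  assumes X[measurable]: "random_variable S X" and Y[measurable]: "random_variable T Y"
    and h[measurable]: "h \<in> T \<rightarrow>\<^sub>M R"
    and indep: "indep_set (sets (vimage_algebra (space M) X S)) (sets (vimage_algebra (space M) Y T))"
  shows "distr M (S \<Otimes>\<^sub>M R) (\<lambda>\<omega>. (X \<omega>, h (Y \<omega>))) = distr M S X \<Otimes>\<^sub>M distr M R (\<lambda>\<omega>. h (Y \<omega>))"
proof (rule pair_measure_eqI[symmetric])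
  have hY[measurable]: "random_variable R (\<lambda>\<omega>. h (Y \<omega>))"
    by (rule measurable_compose[OF Y h])
  show "sigma_finite_measure (distr M S X)"
    by (intro prob_space_imp_sigma_finite prob_space_distr X)
  show "sigma_finite_measure (distr M R (\<lambda>\<omega>. h (Y \<omega>)))"
    by (intro prob_space_imp_sigma_finite prob_space_distr hY)
  show "sets (distr M S X \<Otimes>\<^sub>M distr M R (\<lambda>\<omega>. h (Y \<omega>))) =
      sets (distr M (S \<Otimes>\<^sub>M R) (\<lambda>\<omega>. (X \<omega>, h (Y \<omega>))))"
    by (simp cong: sets_pair_measure_cong)
  fix A B assume "A \<in> sets (distr M S X)" "B \<in> sets (distr M R (\<lambda>\<omega>. h (Y \<omega>)))"
  then have A[measurable]: "A \<in> sets S" and B[measurable]: "B \<in> sets R" by simp_all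
  have "X -` A \<inter> space M \<in> sets (vimage_algebra (space M) X S)"
    by (rule in_vimage_algebra) fact
  moreover have "(\<lambda>\<omega>. h (Y \<omega>)) -` B \<inter> space M = Y -` (h -` B \<inter> space T) \<inter> space M"
    using measurable_space[OF Y] by auto
  moreover have "Y -` (h -` B \<inter> space T) \<inter> space M \<in> sets (vimage_algebra (space M) Y T)"
    by (rule in_vimage_algebra) measurable
  ultimately have "prob ((X -` A \<inter> space M) \<inter> ((\<lambda>\<omega>. h (Y \<omega>)) -` B \<inter> space M)) =
      prob (X -` A \<inter> space M) * prob ((\<lambda>\<omega>. h (Y \<omega>)) -` B \<inter> space M)"
    using indep_setD[OF indep] by metis
  moreover have "(\<lambda>\<omega>. (X \<omega>, h (Y \<omega>))) -` (A \<times> B) \<inter> space M =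
      (X -` A \<inter> space M) \<inter> ((\<lambda>\<omega>. h (Y \<omega>)) -` B \<inter> space M)"
    by auto
  ultimately show "emeasure (distr M S X) A * emeasure (distr M R (\<lambda>\<omega>. h (Y \<omega>))) B =
      emeasure (distr M (S \<Otimes>\<^sub>M R) (\<lambda>\<omega>. (X \<omega>, h (Y \<omega>)))) (A \<times> B)"
    by (simp add: emeasure_distr emeasure_eq_measure ennreal_mult)
qed

section \<open>The expected share of one test point\<close>

lemma false_selection_share_measurable:
  fixes b :: "'w \<Rightarrow> 'n::finite + 'm::finite \<Rightarrow> bool" and T :: "'w \<Rightarrow> real^('n + 'm)" and u :: "'w \<Rightarrow> 'm \<Rightarrow> real"
  assumes \<alpha>: "0 \<le> \<alpha>" "\<alpha> \<le> 1"
    and b[measurable]: "\<And>k. Measurable.pred N (\<lambda>x. b x k)"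
    and T[measurable]: "\<And>k. (\<lambda>x. T x $ k) \<in> borel_measurable N"
    and u[measurable]: "\<And>j. (\<lambda>x. u x j) \<in> borel_measurable N"
  shows "(\<lambda>x. false_selection_share \<alpha> (b x) (T x) (u x) j) \<in> borel_measurable N"
proof -
  note [measurable] = scip_selection_measurable[OF \<alpha>, where N = N and b = "\<lambda>x i. b x (Inl i)" and T = T and u = u]
    card_scip_selection_measurable[OF \<alpha>, where N = N and b = "\<lambda>x i. b x (Inl i)" and T = T and u = u]
  show ?thesis
    unfolding false_selection_share_def Let_def of_bool_def of_nat_max
    by measurable
qed

text \<open>The miscoverage indicators \<open>b\<close> and the scores \<open>T\<close> enter only
  through measurability and equivariance; no formula for them is involved.\<close>

lemma nn_integral_false_selection_share_le:
  fixes Z :: "'n::finite + 'm::finite \<Rightarrow> 'a \<Rightarrow> 'z" and T :: "('n + 'm \<Rightarrow> 'z) \<Rightarrow> 'd \<Rightarrow> real^('n + 'm)"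
    and U :: "'m \<Rightarrow> 'a \<Rightarrow> real" and N :: "'z measure" and MD :: "'d measure"
  defines "P \<equiv> Pi\<^sub>M UNIV (\<lambda>_. N) \<Otimes>\<^sub>M MD" and "Q \<equiv> Pi\<^sub>M UNIV (\<lambda>_. borel)"
  assumes "prob_space M" and \<alpha>: "0 \<le> \<alpha>" "\<alpha> \<le> 1"
    and Z[measurable]: "\<And>i. Z i \<in> M \<rightarrow>\<^sub>M N"
    and D[measurable]: "D \<in> M \<rightarrow>\<^sub>M MD"
    and exch: "cond_exchangeable M N Z MD D"
    and U_law: "distr M Q (\<lambda>\<omega> j. U j \<omega>) = Pi\<^sub>M UNIV (\<lambda>_. uniform_measure lborel {0<..<1})"
    and indep: "distr M (Q \<Otimes>\<^sub>M P) (\<lambda>\<omega>. (\<lambda>j. U j \<omega>, (\<lambda>i. Z i \<omega>, D \<omega>))) =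
      distr M Q (\<lambda>\<omega> j. U j \<omega>) \<Otimes>\<^sub>M distr M P (\<lambda>\<omega>. (\<lambda>i. Z i \<omega>, D \<omega>))"
    and U[measurable]: "\<And>j. U j \<in> borel_measurable M"
    and b: "\<And>k. Measurable.pred P (\<lambda>w. b (fst w) (snd w) k)"
    and T: "\<And>k. (\<lambda>w. T (fst w) (snd w) $ k) \<in> borel_measurable P"
    and b_perm: "\<And>\<sigma> z d k. \<sigma> permutes UNIV \<Longrightarrow> (z, d) \<in> space P \<Longrightarrow> b (\<lambda>i. z (\<sigma> i)) d k = b z d (\<sigma> k)"
    and T_perm: "\<And>\<sigma> z d. \<sigma> permutes UNIV \<Longrightarrow> (z, d) \<in> space P \<Longrightarrow>
      T (\<lambda>i. z (\<sigma> i)) d = (\<chi> k. T z d $ \<sigma> k)"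
  shows "(\<integral>\<^sup>+\<omega>. ennreal (false_selection_share \<alpha> (b (\<lambda>i. Z i \<omega>) (D \<omega>)) (T (\<lambda>i. Z i \<omega>) (D \<omega>)) (\<lambda>j. U j \<omega>) j) \<partial>M)
    \<le> ennreal (\<alpha> / real CARD('m))"
proof -
  interpret prob_space M by fact
  let ?unif = "uniform_measure lborel {0<..<1::real}"
  let ?W = "\<lambda>\<omega>. (\<lambda>i. Z i \<omega>, D \<omega>)" and ?V = "\<lambda>\<omega> j. U j \<omega>"
  define \<nu> where "\<nu> = distr M P ?W"
  define \<mu> where "\<mu> = distr M Q ?V"
  have V[measurable]: "?V \<in> M \<rightarrow>\<^sub>M Q"
    unfolding Q_def by (rule measurable_PiM_single') (auto simp: Pi_iff space_PiM)
  have Zv[measurable]: "(\<lambda>\<omega> i. Z (\<sigma> i) \<omega>) \<in> M \<rightarrow>\<^sub>M Pi\<^sub>M UNIV (\<lambda>_. N)" for \<sigma> :: "'n + 'm \<Rightarrow> 'n + 'm"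
    by (rule measurable_PiM_single') (auto simp: Pi_iff space_PiM measurable_space[OF Z])
  have W\<sigma>[measurable]: "(\<lambda>\<omega>. (\<lambda>i. Z (\<sigma> i) \<omega>, D \<omega>)) \<in> M \<rightarrow>\<^sub>M P" for \<sigma> :: "'n + 'm \<Rightarrow> 'n + 'm"
    unfolding P_def by measurable
  have W[measurable]: "?W \<in> M \<rightarrow>\<^sub>M P" by (rule W\<sigma>)
  have joint: "distr M (Q \<Otimes>\<^sub>M P) (\<lambda>\<omega>. (?V \<omega>, ?W \<omega>)) = \<mu> \<Otimes>\<^sub>M \<nu>"
    unfolding \<mu>_def \<nu>_def by (rule indep)
  interpret \<nu>: prob_space \<nu> unfolding \<nu>_def by (rule prob_space_distr) fact
  interpret \<mu>: prob_space \<mu> unfolding \<mu>_def by (rule prob_space_distr) fact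
  interpret \<mu>\<nu>: pair_prob_space \<mu> \<nu> ..
  have sets_\<mu>\<nu>: "sets (\<mu> \<Otimes>\<^sub>M \<nu>) = sets (Q \<Otimes>\<^sub>M P)"
    by (rule sets_pair_measure_cong) (simp_all add: \<mu>_def \<nu>_def)
  interpret unif: prob_space ?unif
    by (rule prob_space_uniform_measure) auto
  interpret product_sigma_finite "\<lambda>_::'m. ?unif" ..
  \<comment> \<open>For \<open>k = Inr j\<close> the transposition is the identity, so
    \<open>h (Inr j)\<close> is the integrand to be bounded.\<close>
  define h where "h k u w = ennreal (false_selection_share \<alpha>
      (\<lambda>i. b (fst w) (snd w) (Transposition.transpose (Inr j) k i))
      (\<chi> i. T (fst w) (snd w) $ Transposition.transpose (Inr j) k i) u j)"
    for k u and w :: "('n + 'm \<Rightarrow> 'z) \<times> 'd"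
  have h_meas: "(\<lambda>x. h k (f x) (g x)) \<in> borel_measurable L"
    if [measurable]: "f \<in> L \<rightarrow>\<^sub>M Q" "g \<in> L \<rightarrow>\<^sub>M P" for L :: "'l measure" and f g k
    unfolding h_def
    using measurable_compose[OF that(2) b] measurable_compose[OF that(2) T] that(1)[unfolded Q_def]
    by (intro measurable_compose[OF _ measurable_ennreal] false_selection_share_measurable \<alpha>)
      (auto intro: measurable_compose[OF _ measurable_component_singleton])
  let ?I = "\<integral>\<^sup>+\<omega>. ennreal (false_selection_share \<alpha> (b (\<lambda>i. Z i \<omega>) (D \<omega>)) (T (\<lambda>i. Z i \<omega>) (D \<omega>)) (\<lambda>j. U j \<omega>) j) \<partial>M"
  have h_\<mu>\<nu>[measurable]: "(\<lambda>x. h k (fst x) (snd x)) \<in> borel_measurable (\<mu> \<Otimes>\<^sub>M \<nu>)" for k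
    unfolding measurable_cong_sets[OF sets_\<mu>\<nu> refl] by (rule h_meas) measurable
  have h_\<nu>: "h k u \<in> borel_measurable P" for k u
    by (rule h_meas) (auto simp: Q_def space_PiM)
  define I where "I = (\<integral>\<^sup>+x. h (Inr j) (fst x) (snd x) \<partial>(\<mu> \<Otimes>\<^sub>M \<nu>))"
  have I_eq: "(\<integral>\<^sup>+\<omega>. ennreal (false_selection_share \<alpha> (b (\<lambda>i. Z i \<omega>) (D \<omega>)) (T (\<lambda>i. Z i \<omega>) (D \<omega>))
      (\<lambda>j. U j \<omega>) j) \<partial>M) = I"
  proof -
    have "(\<lambda>x. h (Inr j) (fst x) (snd x)) \<in> borel_measurable (Q \<Otimes>\<^sub>M P)"
      by (rule h_meas) measurable
    then show ?thesis
      unfolding I_def joint[symmetric] by (subst nn_integral_distr) (simp_all add: h_def)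
  qed
  \<comment> \<open>Independence allows \<open>u\<close> to be frozen. By equivariance, relabelling
    inside \<open>h\<close> is the same as transposing the data, and that leaves their joint law
    with \<open>D\<close> unchanged.\<close>
  have swap: "(\<integral>\<^sup>+x. h k (fst x) (snd x) \<partial>(\<mu> \<Otimes>\<^sub>M \<nu>)) = I" for k
  proof -
    let ?\<tau> = "Transposition.transpose (Inr j) k"
    have \<tau>: "?\<tau> permutes UNIV" by (rule permutes_swap_id) auto
    have law: "distr M P (\<lambda>\<omega>. (\<lambda>i. Z (?\<tau> i) \<omega>, D \<omega>)) = \<nu>"
      unfolding \<nu>_def P_def by (rule cond_exchangeable_distr_eq[OF assms(3) Z D exch \<tau>])
    have "(\<integral>\<^sup>+w. h k u w \<partial>\<nu>) = (\<integral>\<^sup>+w. h (Inr j) u w \<partial>\<nu>)" for u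
    proof -
      have "(\<integral>\<^sup>+w. h k u w \<partial>\<nu>) = (\<integral>\<^sup>+\<omega>. h k u (?W \<omega>) \<partial>M)"
        unfolding \<nu>_def by (rule nn_integral_distr[OF W]) (simp add: h_\<nu>)
      also have "\<dots> = (\<integral>\<^sup>+\<omega>. h (Inr j) u (\<lambda>i. Z (?\<tau> i) \<omega>, D \<omega>) \<partial>M)"
      proof (rule nn_integral_cong)
        fix \<omega> assume "\<omega> \<in> space M"
        then have "?W \<omega> \<in> space P" by (rule measurable_space[OF W])
        then show "h k u (?W \<omega>) = h (Inr j) u (\<lambda>i. Z (?\<tau> i) \<omega>, D \<omega>)"
          using b_perm[OF \<tau>, of "\<lambda>i. Z i \<omega>" "D \<omega>"] T_perm[OF \<tau>, of "\<lambda>i. Z i \<omega>" "D \<omega>"]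
          by (simp add: h_def)
      qed
      also have "\<dots> = (\<integral>\<^sup>+w. h (Inr j) u w \<partial>distr M P (\<lambda>\<omega>. (\<lambda>i. Z (?\<tau> i) \<omega>, D \<omega>)))"
        by (rule nn_integral_distr[OF W\<sigma>, symmetric]) (simp add: h_\<nu>)
      finally show ?thesis unfolding law .
    qed
    then show ?thesis
      unfolding I_def by (simp add: \<nu>.nn_integral_fst[OF h_\<mu>\<nu>, symmetric])
  qed
  let ?c = "(real CARD('n) + 1) * \<alpha> / real CARD('m)"
  have inner: "(\<integral>\<^sup>+u. (\<Sum>k\<in>slots j. h k u w) \<partial>\<mu>) \<le> ennreal ?c" if w: "w \<in> space P" for w
  proof -
    let ?PJ = "Pi\<^sub>M (UNIV - {j}) (\<lambda>_. ?unif)"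
    interpret PJ: prob_space ?PJ by (rule prob_space_PiM) unfold_locales
    \<comment> \<open>The coordinate \<open>j\<close> is split off from the product of uniform laws,
      so that the inner integral is over \<open>U j\<close> alone.\<close>
    have \<mu>: "\<mu> = Pi\<^sub>M (insert j (UNIV - {j})) (\<lambda>_. ?unif)"
      unfolding \<mu>_def U_law by (simp add: insert_UNIV)
    have sets_\<mu>: "sets \<mu> = sets Q" by (simp add: \<mu>_def)
    have "(\<lambda>u. \<Sum>k\<in>slots j. h k u w) \<in> borel_measurable \<mu>"
      unfolding measurable_cong_sets[OF sets_\<mu> refl]
      using w by (intro borel_measurable_sum h_meas) auto
    then have "(\<integral>\<^sup>+u. (\<Sum>k\<in>slots j. h k u w) \<partial>\<mu>) =
        (\<integral>\<^sup>+u. \<integral>\<^sup>+v. (\<Sum>k\<in>slots j. h k (u(j := v)) w) \<partial>?unif \<partial>?PJ)"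
      unfolding \<mu> by (intro product_nn_integral_insert) auto
    also have "\<dots> = (\<integral>\<^sup>+u. (\<Sum>k\<in>slots j. \<integral>\<^sup>+v. h k (u(j := v)) w \<partial>?unif) \<partial>?PJ)"
    proof (intro nn_integral_cong nn_integral_sum h_meas)
      fix u :: "'m \<Rightarrow> real"
      show "(\<lambda>v. u(j := v)) \<in> ?unif \<rightarrow>\<^sub>M Q"
        unfolding Q_def
      proof (rule measurable_PiM_single')
        show "(\<lambda>v. (u(j := v)) l) \<in> ?unif \<rightarrow>\<^sub>M borel" for l
          by (cases "l = j") auto
      qed (auto simp: space_PiM)
    qed (use w in auto)
    also have "\<dots> \<le> (\<integral>\<^sup>+u. ennreal ?c \<partial>?PJ)"
      unfolding h_def by (intro nn_integral_mono sum_false_selection_share_le \<alpha>)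
    also have "\<dots> = ennreal ?c" by (simp add: PJ.emeasure_space_1)
    finally show ?thesis .
  qed
  \<comment> \<open>All n + 1 slots give the same integral \<open>I\<close>, so the bound on their
    sum, divided by n + 1, bounds \<open>I\<close>.\<close>
  have "ennreal (real CARD('n) + 1) * I = (\<Sum>k\<in>(slots j :: ('n + 'm) set). I)"
    by (simp add: card_slots ennreal_of_nat_eq_real_of_nat add.commute)
  also have "\<dots> = (\<integral>\<^sup>+x. (\<Sum>k\<in>slots j. h k (fst x) (snd x)) \<partial>(\<mu> \<Otimes>\<^sub>M \<nu>))"
    by (subst nn_integral_sum) (simp_all add: swap)
  also have "\<dots> = (\<integral>\<^sup>+w. \<integral>\<^sup>+u. (\<Sum>k\<in>slots j. h k u w) \<partial>\<mu> \<partial>\<nu>)"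
    by (subst \<mu>\<nu>.nn_integral_snd[symmetric]) simp_all
  also have "\<dots> \<le> (\<integral>\<^sup>+w. ennreal ?c \<partial>\<nu>)"
    by (intro nn_integral_mono inner) (simp add: \<nu>_def)
  also have "\<dots> = ennreal ?c" by (simp add: \<nu>.emeasure_space_1)
  also have "\<dots> = ennreal (real CARD('n) + 1) * ennreal (\<alpha> / real CARD('m))"
    using \<alpha> by (simp add: ennreal_mult[symmetric] del: ennreal_plus)
  finally have "I \<le> ennreal (\<alpha> / real CARD('m))"
    by (subst (asm) ennreal_mult_le_mult_iff) auto
  then show ?thesis by (simp only: I_eq)
qed

section \<open>From the individual shares to the false coverage rate\<close>

theorem corollary8:
  fixes M :: "'a measure"
    and MX :: "'x measure" and MY :: "'y measure"
    and MD :: "'d measure" and Mtr :: "'t measure"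
    and Z :: "'n::finite + 'm::finite \<Rightarrow> 'a \<Rightarrow> 'x \<times> 'y"
    and D :: "'a \<Rightarrow> 'd" and Dtr :: "'a \<Rightarrow> 't"
    and U :: "'m \<Rightarrow> 'a \<Rightarrow> real"
    and \<I> :: "'y set set"
    and C :: "('n + 'm \<Rightarrow> 'x \<times> 'y) \<Rightarrow> 'd \<Rightarrow> 'x \<Rightarrow> 'y set"
    and \<psi> :: "('n + 'm \<Rightarrow> 'x \<times> 'y) \<Rightarrow> 'd \<Rightarrow> 'x \<Rightarrow> real"
    and s :: "'x \<Rightarrow> 'x \<Rightarrow> real"
    and \<alpha> :: real
  assumes "prob_space M"
    and alpha: "0 < \<alpha>" "\<alpha> < 1"
    and Z_measurable: "\<And>i. Z i \<in> M \<rightarrow>\<^sub>M MX \<Otimes>\<^sub>M MY"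
    and D_measurable: "D \<in> M \<rightarrow>\<^sub>M MD"
    and Dtr_measurable: "Dtr \<in> M \<rightarrow>\<^sub>M Mtr"
    and U_uniform: "\<And>j. distr M borel (U j) = uniform_measure lborel {0<..<1}"
    and U_indep: "prob_space.indep_vars M (\<lambda>_. borel) U UNIV"
    and U_indep_data: "prob_space.indep_set M
          (sets (vimage_algebra (space M) (\<lambda>\<omega> j. U j \<omega>) (Pi\<^sub>M UNIV (\<lambda>_. borel))))
          (sets (vimage_algebra (space M) (\<lambda>\<omega>. ((\<lambda>i. Z i \<omega>), D \<omega>, Dtr \<omega>))
            (Pi\<^sub>M UNIV (\<lambda>_. MX \<Otimes>\<^sub>M MY) \<Otimes>\<^sub>M (MD \<Otimes>\<^sub>M Mtr))))"
    and I_subsets: "\<I> \<subseteq> Pow (space MY)"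
    and C_range: "\<And>z d x. z \<in> space (Pi\<^sub>M UNIV (\<lambda>_. MX \<Otimes>\<^sub>M MY)) \<Longrightarrow> d \<in> space MD \<Longrightarrow>
          x \<in> space MX \<Longrightarrow> C z d x \<in> \<I>"
    and C_measurable: "Measurable.pred
          ((MX \<Otimes>\<^sub>M MY) \<Otimes>\<^sub>M (Pi\<^sub>M UNIV (\<lambda>_. MX \<Otimes>\<^sub>M MY) \<Otimes>\<^sub>M MD))
          (\<lambda>((x, y), (z, d)). y \<in> C z d x)"
    and C_invariant: "permutation_invariant M MX MY MD Z D C"
    and psi_range: "\<And>z d x. z \<in> space (Pi\<^sub>M UNIV (\<lambda>_. MX \<Otimes>\<^sub>M MY)) \<Longrightarrow> d \<in> space MD \<Longrightarrow>
          x \<in> space MX \<Longrightarrow> \<psi> z d x \<in> {0..1}"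
    and psi_measurable: "(\<lambda>(x, (z, d)). \<psi> z d x) \<in>
          borel_measurable (MX \<Otimes>\<^sub>M (Pi\<^sub>M UNIV (\<lambda>_. MX \<Otimes>\<^sub>M MY) \<Otimes>\<^sub>M MD))"
    and psi_invariant: "permutation_invariant M MX MY MD Z D \<psi>"
    and s_nonneg: "\<And>x x'. x \<in> space MX \<Longrightarrow> x' \<in> space MX \<Longrightarrow> 0 \<le> s x x'"
    and s_measurable: "(\<lambda>(x, x'). s x x') \<in> borel_measurable (MX \<Otimes>\<^sub>M MX)"
    and Z_exchangeable: "cond_exchangeable M (MX \<Otimes>\<^sub>M MY) Z Mtr Dtr"
    and A_pos_def: "AE \<omega> in M. positive_definite (diversity_matrix s \<psi> (\<lambda>i. Z i \<omega>) (D \<omega>))"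
  shows "FCR M
      (\<lambda>\<omega>. scip_selection \<alpha>
        (\<lambda>i. miscovered C (\<lambda>k. Z k \<omega>) (D \<omega>) (Inl i))
        (diversity_scores \<alpha> s \<psi> (\<lambda>k. Z k \<omega>) (D \<omega>))
        (\<lambda>j. U j \<omega>))
      (\<lambda>\<omega> j. miscovered C (\<lambda>k. Z k \<omega>) (D \<omega>) (Inr j)) \<le> \<alpha>"
proof -
  interpret prob_space M by fact
  let ?N = "MX \<Otimes>\<^sub>M MY"
  let ?PZ = "Pi\<^sub>M UNIV (\<lambda>_. ?N) :: ('n + 'm \<Rightarrow> 'x \<times> 'y) measure"
  let ?P = "?PZ \<Otimes>\<^sub>M MD"
  let ?Q = "Pi\<^sub>M UNIV (\<lambda>_. borel) :: ('m \<Rightarrow> real) measure"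
  let ?z = "\<lambda>\<omega> i. Z i \<omega>"
  note [measurable] = Z_measurable D_measurable Dtr_measurable
  have \<alpha>: "0 \<le> \<alpha>" "\<alpha> \<le> 1" using alpha by simp_all
  have U[measurable]: "U j \<in> borel_measurable M" for j
    using U_indep by (simp add: indep_vars_def2)
  have V: "(\<lambda>\<omega> j. U j \<omega>) \<in> M \<rightarrow>\<^sub>M ?Q"
    by (rule measurable_PiM_single') (auto simp: Pi_iff space_PiM)
  have Zv[measurable]: "?z \<in> M \<rightarrow>\<^sub>M ?PZ"
    by (rule measurable_PiM_single') (auto simp: Pi_iff space_PiM measurable_space[OF Z_measurable])
  have W: "(\<lambda>\<omega>. (?z \<omega>, D \<omega>)) \<in> M \<rightarrow>\<^sub>M ?P" by measurable
  have U_law: "distr M ?Q (\<lambda>\<omega> j. U j \<omega>) = Pi\<^sub>M UNIV (\<lambda>_. uniform_measure lborel {0<..<1})"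
    using U_indep indep_vars_iff_distr_eq_PiM[where I = UNIV and M' = "\<lambda>_. borel" and X = U]
    by (simp add: U_uniform restrict_UNIV)
  have indep: "distr M (?Q \<Otimes>\<^sub>M ?P) (\<lambda>\<omega>. (\<lambda>j. U j \<omega>, (?z \<omega>, D \<omega>))) =
      distr M ?Q (\<lambda>\<omega> j. U j \<omega>) \<Otimes>\<^sub>M distr M ?P (\<lambda>\<omega>. (?z \<omega>, D \<omega>))"
  proof -
    have data: "(\<lambda>\<omega>. (?z \<omega>, D \<omega>, Dtr \<omega>)) \<in> M \<rightarrow>\<^sub>M ?PZ \<Otimes>\<^sub>M (MD \<Otimes>\<^sub>M Mtr)" by measurable
    have "(\<lambda>w. (fst w, fst (snd w))) \<in> ?PZ \<Otimes>\<^sub>M (MD \<Otimes>\<^sub>M Mtr) \<rightarrow>\<^sub>M ?P" by measurable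
    from indep_set_vimage_distr_pair[OF V data this U_indep_data] show ?thesis
      by (simp only: fst_conv snd_conv)
  qed
  \<comment> \<open>Exchangeability given \<open>Dtr\<close> is first weakened to unconditional
    exchangeability. This is the premise of the second clause of
    \<open>permutation_invariant\<close>, which then returns exchangeability given
    \<open>D\<close>.\<close>
  have exch: "cond_exchangeable M ?N Z MD D"
    using C_invariant
      cond_exchangeable_imp_exchangeable[OF assms(1) Z_measurable Dtr_measurable Z_exchangeable]
    by (simp add: permutation_invariant_def)
  have b_meas: "Measurable.pred ?P (\<lambda>w. miscovered C (fst w) (snd w) k)" for k
  proof -
    have "(\<lambda>w. (fst w k, w)) \<in> ?P \<rightarrow>\<^sub>M ?N \<Otimes>\<^sub>M ?P" by measurable
    from measurable_compose[OF this C_measurable] show ?thesis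
      by (simp add: miscovered_def case_prod_beta)
  qed
  have T_meas: "(\<lambda>w. cramer_scores \<alpha> s \<psi> (fst w) (snd w) $ k) \<in> borel_measurable ?P" for k
    using cramer_scores_measurable[OF psi_measurable s_measurable] by (simp add: case_prod_beta)
  have space_fst: "fst (z i) \<in> space MX" if "(z, d) \<in> space ?P" for z d i
    using that by (auto simp: space_pair_measure space_PiM PiE_def Pi_iff mem_Times_iff)
  have b_perm: "miscovered C (\<lambda>i. z (\<sigma> i)) d k = miscovered C z d (\<sigma> k)"
    if "\<sigma> permutes UNIV" "(z, d) \<in> space ?P" for \<sigma> z d k
  proof -
    have "C z d (fst (z (\<sigma> k))) = C (\<lambda>i. z (\<sigma> i)) d (fst (z (\<sigma> k)))"
      using C_invariant that space_fst[OF that(2)]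
      unfolding permutation_invariant_def space_pair_measure mem_Times_iff fst_conv snd_conv by blast
    then show ?thesis by (simp add: miscovered_def)
  qed
  have T_perm: "cramer_scores \<alpha> s \<psi> (\<lambda>i. z (\<sigma> i)) d = (\<chi> k. cramer_scores \<alpha> s \<psi> z d $ \<sigma> k)"
    if "\<sigma> permutes UNIV" "(z, d) \<in> space ?P" for \<sigma> z d
  proof (rule cramer_scores_permute[OF that(1)])
    fix i
    show "\<psi> (\<lambda>i. z (\<sigma> i)) d (fst (z i)) = \<psi> z d (fst (z i))"
      using psi_invariant that space_fst[OF that(2)]
      unfolding permutation_invariant_def space_pair_measure mem_Times_iff fst_conv snd_conv by metis
  qed
  define g where "g \<omega> j = false_selection_share \<alpha> (miscovered C (?z \<omega>) (D \<omega>))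
      (cramer_scores \<alpha> s \<psi> (?z \<omega>) (D \<omega>)) (\<lambda>j. U j \<omega>) j" for \<omega> j
  have g_le: "(\<integral>\<^sup>+\<omega>. ennreal (g \<omega> j) \<partial>M) \<le> ennreal (\<alpha> / real CARD('m))" for j
    unfolding g_def
    by (rule nn_integral_false_selection_share_le[OF assms(1) \<alpha> Z_measurable D_measurable exch U_law
          indep U b_meas T_meas b_perm T_perm])
  have g_meas: "(\<lambda>\<omega>. g \<omega> j) \<in> borel_measurable M" for j
    unfolding g_def
    using measurable_compose[OF W b_meas] measurable_compose[OF W T_meas]
    by (intro false_selection_share_measurable \<alpha>) auto
  have g_nonneg: "0 \<le> g \<omega> j" for \<omega> j
    by (simp add: g_def false_selection_share_def Let_def)
  have U_AE: "AE \<omega> in M. \<forall>l. 0 < U l \<omega> \<and> U l \<omega> < 1"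
  proof (subst AE_all_countable, intro allI)
    fix l
    have "AE v in distr M borel (U l). 0 < v \<and> v < 1"
      unfolding U_uniform by (rule AE_uniform_measureI) auto
    then show "AE \<omega> in M. 0 < U l \<omega> \<and> U l \<omega> < 1"
      by (subst (asm) AE_distr_iff) auto
  qed
  define S where "S \<omega> = scip_selection \<alpha> (\<lambda>i. miscovered C (?z \<omega>) (D \<omega>) (Inl i))
      (diversity_scores \<alpha> s \<psi> (?z \<omega>) (D \<omega>)) (\<lambda>j. U j \<omega>)" for \<omega>
  define f where "f \<omega> = (\<Sum>j\<in>S \<omega>. of_bool (miscovered C (?z \<omega>) (D \<omega>) (Inr j))) / real (max 1 (card (S \<omega>)))"
    for \<omega>
  \<comment> \<open>Two null sets are discarded: where some \<open>U l\<close> leaves the open unit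
    interval, and where the matrix is not positive definite, so that \<open>cramer_scores\<close>
    may differ from \<open>diversity_scores\<close>.\<close>
  have f_eq: "AE \<omega> in M. f \<omega> = (\<Sum>j\<in>UNIV. g \<omega> j)"
    using U_AE A_pos_def
  proof eventually_elim
    case (elim \<omega>)
    have "g \<omega> j = of_bool (j \<in> S \<omega>) * of_bool (miscovered C (?z \<omega>) (D \<omega>) (Inr j)) / real (max 1 (card (S \<omega>)))"
      for j
      using elim(1)
      by (simp add: g_def false_selection_share_def S_def diversity_scores_eq_cramer_scores[OF elim(2)] Let_def of_bool_def)
    moreover have "(\<Sum>j\<in>S \<omega>. c j) = (\<Sum>j\<in>UNIV. of_bool (j \<in> S \<omega>) * c j)" for c :: "'m \<Rightarrow> real"
      by (rule sum.mono_neutral_cong_left) auto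
    ultimately show ?case
      by (simp only: f_def sum_divide_distrib)
  qed
  \<comment> \<open>Measurability of \<open>f\<close> is not established, since
    \<open>matrix_inv\<close> is unspecified on singular matrices. If \<open>f\<close> is not
    integrable, its integral is 0 by convention, which is at most \<alpha>; otherwise almost sure
    equality suffices.\<close>
  have "integral\<^sup>L M f = (\<integral>\<omega>. (\<Sum>j\<in>UNIV. g \<omega> j) \<partial>M)" if "integrable M f"
    using that f_eq g_meas by (intro integral_cong_AE) auto
  moreover have "(\<integral>\<omega>. (\<Sum>j\<in>UNIV. g \<omega> j) \<partial>M) \<le> \<alpha>"
  proof -
    have "(\<integral>\<^sup>+\<omega>. ennreal (\<Sum>j\<in>UNIV. g \<omega> j) \<partial>M) = (\<Sum>j\<in>UNIV. \<integral>\<^sup>+\<omega>. ennreal (g \<omega> j) \<partial>M)"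
      using g_meas g_nonneg by (subst nn_integral_sum[symmetric]) (auto simp: sum_ennreal)
    also have "\<dots> \<le> (\<Sum>j\<in>(UNIV :: 'm set). ennreal (\<alpha> / real CARD('m)))"
      by (intro sum_mono g_le)
    also have "\<dots> = ennreal \<alpha>"
      using \<alpha> by (simp add: ennreal_of_nat_eq_real_of_nat ennreal_mult[symmetric])
    finally show ?thesis
      using g_meas g_nonneg \<alpha>
      by (subst integral_eq_nn_integral) (auto intro!: enn2real_leI sum_nonneg)
  qed
  ultimately have "integral\<^sup>L M f \<le> \<alpha>"
    using \<alpha> by (cases "integrable M f") (simp_all add: not_integrable_integral_eq)
  then show ?thesis
    by (simp only: FCR_def f_def[abs_def] S_def)
qed

end
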